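(* Fix $k\in[1;\overline{N}]$ and consider the strongly connected component $\mathrm{Scc}_k$ with vertex set $\mathcal{V}_k$, and the interconnection $\Sigma_{\mathrm{Scc}_k}$. Assume: (A1) For each $i\in[1;N]$ there exist a locally Lipschitz function $V_i:\mathbb{R}^{n_i}\times\mathbb{R}^{n_i}\to\mathbb{R}_0^+$, $\mathcal{K}_\infty$ functions $\underline{\alpha}_i,\overline{\alpha}_i,\rho_i$ and $\mathcal{K}$ functions $\sigma_i$ and $\sigma_{i,j}$ ($j\in[1;N]$, $j\neq i$) such that $\underline{\alpha}_i(\Vert x_i-x_i'\Vert)\le V_i(x_i,x_i')\le\overline{\alpha}_i(\Vert x_i-x_i'\Vert)$ for all $x_i,x_i'\in\mathbb{R}^{n_i}$, and $$V_i(f_i(x_1,\dots,x_N,u_i),f_i(x_1',\dots,x_N',u_i'))-V_i(x_i,x_i')\le-\rho_i(V_i(x_i,x_i'))+\sum_{j\in[1;N],\,j\neq i}\sigma_{i,j}(\Vert x_j-x_j'\Vert)+\sigma_i(\Vert u_i-u_i'\Vert)$$ for all $x_j,x_j'\in\mathbb{R}^{n_j}$ ($j\in[1;N]$) and all $u_i,u_i'\in\mathbb{R}^{m_i}$. (A2) There exist $\mathcal{K}_\infty$ functions $g_i^k$ and reals $a_i^k\in\mathbb{R}^+$, $c_{ij}^k\in\mathbb{R}_0^+$ ($i,j\in\mathcal{V}_k$, $j\neq i$) such that $\rho_i(s)\ge a_i^kg_i^k(s)$ and $\sigma_{i,j}\circ\underline{\alpha}_j^{-1}(s)\le c_{ij}^kg_j^k(s)$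 for all $s\in\mathbb{R}^+_0$ and all $i,j\in\mathcal{V}_k$, $j\neq i$. Let $A_k=\mathrm{diag}(a^k_{i(1,k)},\dots,a^k_{i(\overline{N}_k,k)})$, and let $C_k$ be the $\overline{N}_k\times\overline{N}_k$ matrix with zero diagonal and entry $c^k_{i(j,k)i(j',k)}$ in row $j$ and column $j'\neq j$. Assume the spectral radius satisfies $r(A_k^{-1}C_k)<1$. Then, for any vector $\underline{\lambda}_k=(\lambda_{i(1,k)},\dots,\lambda_{i(\overline{N}_k,k)})\in\mathbb{R}^+_{\overline{N}_k}$ with $\underline{\lambda}_k^T(A_k-C_k)>0$ (componentwise), the function $$\overline{V}_k(\xi_k,\xi_k')=\sum_{i\in\mathcal{V}_k}\lambda_iV_i(x_i,x_i'),\qquad \xi_k=(x_i)_{i\in\mathcal{V}_k},\ \xi_k'=(x_i')_{i\in\mathcal{V}_k}\in\mathbb{R}^{\overline{n}_k},$$ is a $\delta$-ISS Lyapunov function for $\Sigma_{\mathrm{Scc}_k}$, i.e. there exist $\mathcal{K}_\infty$ functions $\underline{\alpha}^k,\overline{\alpha}^k,\rho^k$ and $\mathcal{K}$ functions $\sigma^k$, $\sigma^k_j$ ($j\in[1;\overline{N}]$, $j\neq k$) such that (i) $\underline{\alpha}^k(\Vert\xi_k-\xi_k'\Vert)\le\overline{V}_k(\xi_k,\xi_k')\le\overline{\alpha}^k(\Vert\xi_k-\xi_k'\Vert)$ for all $\xi_k,\xi_k'\in\mathbb{R}^{\overline{n}_k}$; (ii) $\overline{V}_k(\varphi_k(\xi_1,\dots,\xi_{\overline{N}},\omega_k),\varphi_k(\xi_1',\dots,\xi_{\overline{N}}',\omega_k'))-\overline{V}_k(\xi_k,\xi_k')\le-\rho^k(\overline{V}_k(\xi_k,\xi_k'))+\sum_{j\in[1;\overline{N}],\,j\neq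 k}\sigma_j^k(\Vert\xi_j-\xi_j'\Vert)+\sigma^k(\Vert\omega_k-\omega_k'\Vert)$ for all $\xi_j,\xi_j'\in\mathbb{R}^{\overline{n}_j}$ ($j\in[1;\overline{N}]$) and all $\omega_k,\omega_k'\in\mathbb{R}^{\overline{m}_k}$. Moreover, with these functions, let $L^k$ be a Lipschitz constant of $\overline{V}_k$ in $\Xi_k\times\Xi_k$. For any $\varepsilon^k\in\mathbb{R}^+$, let $\overline{\eta}\in\mathbb{R}^+_{\overline{N}}$ be any vector satisfying $$L^k\,\overline{\eta}(k)+\sum_{j\in[1;\overline{N}],\,j\neq k}\sigma^k_j(\overline{\eta}(j))+\sigma^k(\overline{\eta}(k))\le(\rho^k\circ\underline{\alpha}^k)(\varepsilon^k),\qquad\overline{\alpha}^k(\overline{\eta}(k))\le\underline{\alpha}^k(\varepsilon^k),$$ and define $\eta\in\mathbb{R}^+_N$ by $\eta(i)=\overline{\eta}(l)$ for all $i\in\mathcal{V}_l$ and $l\in[1;\overline{N}]$. Then the composition $\mathcal{S}(\{S^\eta(\Sigma_i)\}_{i\in\mathcal{V}_k})$ is approximately bisimilar with precision $\varepsilon^k$ to $S(\Sigma_{\mathrm{Scc}_k})$.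
   Context: Notation. $\mathbb{N}_0$ is the set of nonnegative integers; $\mathbb{R}^+$ and $\mathbb{R}^+_0$ are the positive and nonnegative reals; $\mathbb{R}^+_n$ is the positive orthant of $\mathbb{R}^n$; $[1;n]=\{1,\dots,n\}$; $x(i)$ is the $i$-th entry of a vector $x$; $\Vert\cdot\Vert$ is the infinity norm; $r(\cdot)$ is the spectral radius. A continuous $\gamma:\mathbb{R}^+_0\to\mathbb{R}^+_0$ is of class $\mathcal{K}$ if it is strictly increasing with $\gamma(0)=0$, and of class $\mathcal{K}_\infty$ if moreover $\gamma(r)\to\infty$ as $r\to\infty$. For $\eta\in\mathbb{R}^+$ and $X\subseteq\mathbb{R}^n$, $[X]_\eta=(\eta\mathbb{Z}^n)\cap X$; for $x=(x_1,\dots,x_n)\in\mathbb{R}^n$, $[x]_\eta=(\eta\lceil x_1/\eta\rceil,\dots,\eta\lceil x_n/\eta\rceil)$. Network. $\Sigma_1,\dots,\Sigma_N$ are control systems $\Sigma_i:\ x_i(t+1)=f_i(x_1(t),\dots,x_N(t),u_i(t))$, $x_i(t)\in\mathcal{X}_i\subset\mathbb{R}^{n_i}$, $u_i(t)\in\mathcal{U}_i\subset\mathbb{R}^{m_i}$, $t\in\mathbb{N}_0$. With $n=\sum_i n_i$, the functions $f_i:\mathbb{R}^n\times\mathbb{R}^{m_i}\to\mathbb{R}^{n_i}$ are locally Lipschitz with $f_i(0,0)=0$; the sets $\mathcal{X}_i,\mathcal{U}_i$ are convex, bounded and with nonempty interior. Graph. $\mathcal{G}=(\mathcal{V},\mathcal{E})$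 is the directed graph with $\mathcal{V}=[1;N]$ and $(i,j)\in\mathcal{E}$ iff $f_j$ depends explicitly on the variable $x_i$. Its strongly connected components are $\mathrm{Scc}_1,\dots,\mathrm{Scc}_{\overline{N}}$, with vertex sets $\mathcal{V}_k=\{i(1,k),\dots,i(\overline{N}_k,k)\}$. Put $\Xi_k=\prod_{i\in\mathcal{V}_k}\mathcal{X}_i$, $\Omega_k=\prod_{i\in\mathcal{V}_k}\mathcal{U}_i$, $\overline{n}_k=\sum_{i\in\mathcal{V}_k}n_i$, $\overline{m}_k=\sum_{i\in\mathcal{V}_k}m_i$. The interconnection $\Sigma_{\mathrm{Scc}_k}$ of the $\Sigma_i$, $i\in\mathcal{V}_k$, is $\xi_k(t+1)=\varphi_k(\xi_1(t),\dots,\xi_{\overline{N}}(t),\omega_k(t))$, $\xi_k(t)\in\Xi_k$, $\omega_k(t)\in\Omega_k$, where $\xi_j=(x_i)_{i\in\mathcal{V}_j}$, $\omega_k=(u_i)_{i\in\mathcal{V}_k}$ and $\varphi_k:\mathbb{R}^n\times\mathbb{R}^{\overline{m}_k}\to\mathbb{R}^{\overline{n}_k}$ is $\varphi_k=(f_i(x_1,\dots,x_N,u_i))_{i\in\mathcal{V}_k}$. Systems. A system is a quintuple $S=(X,U,\longrightarrow,Y,H)$ with a set of states $X$, a set of inputs $U$, a transition relation $\longrightarrow\subseteq X\times U\times X$ (one writes $x\overset{u}{\longrightarrow}x'$), a set of outputs $Y$ and an output function $H:X\to Y$. It is metric if $Y$ carries a metric $\mathbf{d}$. Approximate bisimulation.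 Let $S^a=(X^a,U^a,\longrightarrow_a,Y^a,H^a)$, $a=1,2$, be metric systems with $Y^1=Y^2$ and the same metric $\mathbf{d}$. $\mathcal{R}\subseteq X^1\times X^2$ is an $\varepsilon$-approximate bisimulation relation if for all $(x^1,x^2)\in\mathcal{R}$: (i) $\mathbf{d}(H^1(x^1),H^2(x^2))\le\varepsilon$; (ii) for any $x^1\overset{u^1}{\longrightarrow}_1x^1_+$ there exists $x^2\overset{u^2}{\longrightarrow}_2x^2_+$ with $(x^1_+,x^2_+)\in\mathcal{R}$; (iii) for any $x^2\overset{u^2}{\longrightarrow}_2x^2_+$ there exists $x^1\overset{u^1}{\longrightarrow}_1x^1_+$ with $(x^1_+,x^2_+)\in\mathcal{R}$. $S^1$ and $S^2$ are approximately bisimilar with precision $\varepsilon$ if there is such an $\mathcal{R}$ with $\mathcal{R}(X^1)=X^2$ and $\mathcal{R}^{-1}(X^2)=X^1$, i.e. every state of each system is related to some state of the other. The system $S(\Sigma_{\mathrm{Scc}_k})$ has state set $\Xi_k$, input set $W^*\times\Omega_k$ with $W^*=\prod_{j\neq k}\Xi_j$, transitions $\xi_k\overset{(\xi_1,\dots,\xi_{k-1},\xi_{k+1},\dots,\xi_{\overline{N}},\omega_k)}{\longrightarrow}\xi_k^+$ if $\xi_k^+=\varphi_k(\xi_1,\dots,\xi_{\overline{N}},\omega_k)$, output set $\Xi_k$, output function $H(\xi_k)=\xi_k$, and metric $\mathbf{d}(\xi_k,\xi_k')=\max_{i\in\mathcal{V}_k}\Vert x_i-x_i'\Vert$. For $\eta\in\mathbb{R}^+_N$,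 the system $S^\eta(\Sigma_i)$ has state set $[\mathcal{X}_i]_{\eta(i)}$, input set $\left(\prod_{j\neq i}[\mathcal{X}_j]_{\eta(j)}\right)\times[\mathcal{U}_i]_{\eta(i)}$, transitions $x_i\overset{(x_1,\dots,x_{i-1},x_{i+1},\dots,x_N,u_i)}{\longrightarrow}x_i^+$ if $x_i^+=[f_i(x_1,\dots,x_N,u_i)]_{\eta(i)}$, output set $\mathcal{X}_i$, output function $H(x_i)=x_i$. The composition $\mathcal{S}(\{S^\eta(\Sigma_i)\}_{i\in\mathcal{V}_k})$ has state set $\prod_{i\in\mathcal{V}_k}[\mathcal{X}_i]_{\eta(i)}$, input set $\left(\prod_{j\notin\mathcal{V}_k}[\mathcal{X}_j]_{\eta(j)}\right)\times\prod_{i\in\mathcal{V}_k}[\mathcal{U}_i]_{\eta(i)}$, a transition from $(x_i)_{i\in\mathcal{V}_k}$ to $(x_i^+)_{i\in\mathcal{V}_k}$ with label $((x_j)_{j\notin\mathcal{V}_k},(u_i)_{i\in\mathcal{V}_k})$ iff for every $i\in\mathcal{V}_k$ there is in $S^\eta(\Sigma_i)$ the transition $x_i\overset{(x_1,\dots,x_{i-1},x_{i+1},\dots,x_N,u_i)}{\longrightarrow}x_i^+$; the output function is $H(x)=x$, and the output set is $\Xi_k$ with the metric above.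
   Formalization: For the bisimilarity it is also assumed that transitions of S(Σ_Scc_k) and of S^η(Σ_i), i∈V_k, stay in the state sets, and that every point of X_i (all i) and of U_i (i∈V_k) is within η(i) of [X_i]_η(i), resp. [U_i]_η(i); otherwise the claim fails, e.g. if [X_i]_η(i) is empty. *)

theory Defs
  imports
    Complex_Main
    "HOL-Library.FuncSet"
    "Jordan_Normal_Form.Spectral_Radius"
    "Jordan_Normal_Form.Gauss_Jordan_Elimination"
    "Graph_Theory.Graph_Theory"
begin

text \<open>
  The subsystems live in spaces of different dimensions, so the space of dimension \<open>d\<close> is the
  carrier \<open>carrier_vec d\<close> of real vectors.  A family \<open>(x\<^sub>i)\<close> indexed by \<open>i \<in> I\<close> is an extensional
  function in \<open>Pi\<^sub>E I ...\<close>; it also stands for the stacked vector of its components.  In the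
  same way an iterated product over the blocks of a partition of the index set is identified with
  the product over the index set itself.
\<close>


subsection \<open>Norms and regularity in the infinity norm\<close>

text \<open>The inserted \<open>0\<close> only matters in dimension zero.\<close>

definition inf_norm :: "real vec \<Rightarrow> real" where
  "inf_norm v = Max (insert 0 ((\<lambda>l. \<bar>vec_index v l\<bar>) ` {..<dim_vec v}))"

definition inf_dist :: "real vec \<Rightarrow> real vec \<Rightarrow> real" where
  "inf_dist x y = inf_norm (x - y)"

text \<open>
  Infinity norm of the difference of two stacked vectors; equivalently, the maximum over the
  components of the norms of their differences.  Used for finite nonempty \<open>I\<close>.
\<close>

definition fam_dist :: "nat set \<Rightarrow> (nat \<Rightarrow> real vec) \<Rightarrow> (nat \<Rightarrow> real vec) \<Rightarrow> real" where
  "fam_dist I x y = Max ((\<lambda>i. inf_dist (x i) (y i)) ` I)"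

text \<open>Infinity norm on a product of two spaces.\<close>

definition pair_dist ::
  "('a \<Rightarrow> 'a \<Rightarrow> real) \<Rightarrow> ('b \<Rightarrow> 'b \<Rightarrow> real) \<Rightarrow> 'a \<times> 'b \<Rightarrow> 'a \<times> 'b \<Rightarrow> real" where
  "pair_dist d e p q = max (d (fst p) (fst q)) (e (snd p) (snd q))"

definition lipschitz_constant ::
  "real \<Rightarrow> 'a set \<Rightarrow> ('a \<Rightarrow> 'a \<Rightarrow> real) \<Rightarrow> ('b \<Rightarrow> 'b \<Rightarrow> real) \<Rightarrow> ('a \<Rightarrow> 'b) \<Rightarrow> bool" where
  "lipschitz_constant L D d e h \<longleftrightarrow> 0 \<le> L \<and> (\<forall>p\<in>D. \<forall>q\<in>D. e (h p) (h q) \<le> L * d p q)"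

definition locally_lipschitz ::
  "'a set \<Rightarrow> ('a \<Rightarrow> 'a \<Rightarrow> real) \<Rightarrow> ('b \<Rightarrow> 'b \<Rightarrow> real) \<Rightarrow> ('a \<Rightarrow> 'b) \<Rightarrow> bool" where
  "locally_lipschitz D d e h \<longleftrightarrow>
     (\<forall>p\<in>D. \<exists>r>0. \<exists>L. lipschitz_constant L {q\<in>D. d p q < r} d e h)"

definition convex_vecs :: "real vec set \<Rightarrow> bool" where
  "convex_vecs S \<longleftrightarrow>
     (\<forall>x\<in>S. \<forall>y\<in>S. \<forall>t. 0 \<le> t \<and> t \<le> 1 \<longrightarrow> (1 - t) \<cdot>\<^sub>v x + t \<cdot>\<^sub>v y \<in> S)"

definition bounded_vecs :: "real vec set \<Rightarrow> bool" where
  "bounded_vecs S \<longleftrightarrow> (\<exists>b. \<forall>x\<in>S. inf_norm x \<le> b)"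

definition interior_vecs :: "nat \<Rightarrow> real vec set \<Rightarrow> real vec set" where
  "interior_vecs d S =
     {x\<in>carrier_vec d. \<exists>r>0. {y\<in>carrier_vec d. inf_dist x y < r} \<subseteq> S}"


subsection \<open>Comparison functions\<close>

text \<open>Only the values on the nonnegative reals matter.\<close>

definition class_K :: "(real \<Rightarrow> real) \<Rightarrow> bool" where
  "class_K \<gamma> \<longleftrightarrow> continuous_on {0..} \<gamma> \<and> strict_mono_on {0..} \<gamma> \<and> \<gamma> 0 = 0"

definition class_Kinf :: "(real \<Rightarrow> real) \<Rightarrow> bool" where
  "class_Kinf \<gamma> \<longleftrightarrow> class_K \<gamma> \<and> filterlim \<gamma> at_top at_top"


subsection \<open>Quantization\<close>

definition lattice_in :: "real \<Rightarrow> real vec set \<Rightarrow> real vec set" where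
  "lattice_in \<eta> S = {x\<in>S. \<forall>l<dim_vec x. \<exists>z::int. vec_index x l = \<eta> * of_int z}"

definition quantize :: "real \<Rightarrow> real vec \<Rightarrow> real vec" where
  "quantize \<eta> x = map_vec (\<lambda>t. \<eta> * of_int \<lceil>t / \<eta>\<rceil>) x"

text \<open>
  Every point of \<open>S\<close> is within \<open>\<eta>\<close> of a lattice point of \<open>S\<close>.  This is what convexity, boundedness
  and nonempty interior are meant to provide, but they do not imply it: the lattice may miss \<open>S\<close>
  altogether when \<open>\<eta>\<close> is large, and may miss sharp corners of \<open>S\<close> for arbitrarily small \<open>\<eta>\<close>.
\<close>

definition lattice_covers :: "real \<Rightarrow> real vec set \<Rightarrow> bool" where
  "lattice_covers \<eta> S \<longleftrightarrow> (\<forall>x\<in>S. \<exists>y\<in>lattice_in \<eta> S. inf_dist x y \<le> \<eta>)"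


subsection \<open>Networks\<close>

text \<open>
  The subsystems are numbered \<open>1, ..., size\<close>.  \<open>dyn i x u\<close> is the value of the \<open>i\<close>-th
  transition function at the joint state \<open>x\<close> and the input \<open>u\<close> of the \<open>i\<close>-th subsystem.
\<close>

record network =
  net_size :: nat
  state_dim :: "nat \<Rightarrow> nat"
  input_dim :: "nat \<Rightarrow> nat"
  dyn :: "nat \<Rightarrow> (nat \<Rightarrow> real vec) \<Rightarrow> real vec \<Rightarrow> real vec"
  state_set :: "nat \<Rightarrow> real vec set"
  input_set :: "nat \<Rightarrow> real vec set"

definition vertices :: "network \<Rightarrow> nat set" where
  "vertices \<Sigma> = {1..net_size \<Sigma>}"

definition state_space :: "network \<Rightarrow> nat set \<Rightarrow> (nat \<Rightarrow> real vec) set" where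
  "state_space \<Sigma> I = (\<Pi>\<^sub>E i\<in>I. carrier_vec (state_dim \<Sigma> i))"

definition input_space :: "network \<Rightarrow> nat set \<Rightarrow> (nat \<Rightarrow> real vec) set" where
  "input_space \<Sigma> I = (\<Pi>\<^sub>E i\<in>I. carrier_vec (input_dim \<Sigma> i))"

definition control_network :: "network \<Rightarrow> bool" where
  "control_network \<Sigma> \<longleftrightarrow>
     (\<forall>i\<in>vertices \<Sigma>.
        (\<forall>x\<in>state_space \<Sigma> (vertices \<Sigma>). \<forall>u\<in>carrier_vec (input_dim \<Sigma> i).
           dyn \<Sigma> i x u \<in> carrier_vec (state_dim \<Sigma> i)) \<and>
        locally_lipschitz (state_space \<Sigma> (vertices \<Sigma>) \<times> carrier_vec (input_dim \<Sigma> i))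
          (pair_dist (fam_dist (vertices \<Sigma>)) inf_dist) inf_dist
          (\<lambda>p. dyn \<Sigma> i (fst p) (snd p)) \<and>
        dyn \<Sigma> i (\<lambda>j\<in>vertices \<Sigma>. 0\<^sub>v (state_dim \<Sigma> j)) (0\<^sub>v (input_dim \<Sigma> i))
          = 0\<^sub>v (state_dim \<Sigma> i) \<and>
        state_set \<Sigma> i \<subseteq> carrier_vec (state_dim \<Sigma> i) \<and>
        convex_vecs (state_set \<Sigma> i) \<and> bounded_vecs (state_set \<Sigma> i) \<and>
        interior_vecs (state_dim \<Sigma> i) (state_set \<Sigma> i) \<noteq> {} \<and>
        input_set \<Sigma> i \<subseteq> carrier_vec (input_dim \<Sigma> i) \<and>
        convex_vecs (input_set \<Sigma> i) \<and> bounded_vecs (input_set \<Sigma> i) \<and>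
        interior_vecs (input_dim \<Sigma> i) (input_set \<Sigma> i) \<noteq> {})"

text \<open>\<open>depends_on \<Sigma> j i\<close>: the \<open>j\<close>-th transition function depends on the \<open>i\<close>-th state variable.\<close>

definition depends_on :: "network \<Rightarrow> nat \<Rightarrow> nat \<Rightarrow> bool" where
  "depends_on \<Sigma> j i \<longleftrightarrow>
     (\<exists>x\<in>state_space \<Sigma> (vertices \<Sigma>). \<exists>x'\<in>state_space \<Sigma> (vertices \<Sigma>).
      \<exists>u\<in>carrier_vec (input_dim \<Sigma> j).
        (\<forall>l\<in>vertices \<Sigma> - {i}. x l = x' l) \<and> dyn \<Sigma> j x u \<noteq> dyn \<Sigma> j x' u)"

definition net_graph :: "network \<Rightarrow> (nat, nat \<times> nat) pre_digraph" where
  "net_graph \<Sigma> = with_proj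
     \<lparr> pverts = vertices \<Sigma>,
       parcs = {(i, j). i \<in> vertices \<Sigma> \<and> j \<in> vertices \<Sigma> \<and> depends_on \<Sigma> j i} \<rparr>"

text \<open>Joint transition function of the subsystems in \<open>I\<close>.\<close>

definition joint_dyn ::
  "network \<Rightarrow> nat set \<Rightarrow> (nat \<Rightarrow> real vec) \<Rightarrow> (nat \<Rightarrow> real vec) \<Rightarrow> nat \<Rightarrow> real vec" where
  "joint_dyn \<Sigma> I x \<omega> = (\<lambda>i\<in>I. dyn \<Sigma> i x (\<omega> i))"


subsection \<open>Systems and approximate bisimulation\<close>

record ('x, 'u, 'y) transition_system =
  sys_states :: "'x set"
  sys_inputs :: "'u set"
  sys_trans :: "('x \<times> 'u \<times> 'x) set"
  sys_outputs :: "'y set"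
  sys_out :: "'x \<Rightarrow> 'y"

definition is_system :: "('x, 'u, 'y) transition_system \<Rightarrow> bool" where
  "is_system S \<longleftrightarrow>
     sys_trans S \<subseteq> sys_states S \<times> sys_inputs S \<times> sys_states S \<and>
     sys_out S \<in> sys_states S \<rightarrow> sys_outputs S"

text \<open>
  The library locale \<open>Metric_space\<close> is not used because it wants nonnegativity and symmetry also
  outside the carrier, where \<open>inf_dist\<close> compares vectors of different dimensions.
\<close>

definition is_metric_on :: "'y set \<Rightarrow> ('y \<Rightarrow> 'y \<Rightarrow> real) \<Rightarrow> bool" where
  "is_metric_on Y d \<longleftrightarrow>
     (\<forall>x\<in>Y. \<forall>y\<in>Y. 0 \<le> d x y \<and> (d x y = 0 \<longleftrightarrow> x = y) \<and> d x y = d y x \<and>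
       (\<forall>z\<in>Y. d x z \<le> d x y + d y z))"

definition metric_system :: "('x, 'u, 'y) transition_system \<Rightarrow> ('y \<Rightarrow> 'y \<Rightarrow> real) \<Rightarrow> bool" where
  "metric_system S d \<longleftrightarrow> is_system S \<and> is_metric_on (sys_outputs S) d"

definition approx_bisimulation ::
  "real \<Rightarrow> ('y \<Rightarrow> 'y \<Rightarrow> real) \<Rightarrow> ('x, 'u, 'y) transition_system \<Rightarrow>
   ('z, 'w, 'y) transition_system \<Rightarrow> ('x \<times> 'z) set \<Rightarrow> bool" where
  "approx_bisimulation \<epsilon> d S T R \<longleftrightarrow>
     R \<subseteq> sys_states S \<times> sys_states T \<and>
     (\<forall>(x, z)\<in>R.
        d (sys_out S x) (sys_out T z) \<le> \<epsilon> \<and>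
        (\<forall>u x'. (x, u, x') \<in> sys_trans S \<longrightarrow>
           (\<exists>w z'. (z, w, z') \<in> sys_trans T \<and> (x', z') \<in> R)) \<and>
        (\<forall>w z'. (z, w, z') \<in> sys_trans T \<longrightarrow>
           (\<exists>u x'. (x, u, x') \<in> sys_trans S \<and> (x', z') \<in> R)))"

definition approx_bisimilar ::
  "real \<Rightarrow> ('y \<Rightarrow> 'y \<Rightarrow> real) \<Rightarrow> ('x, 'u, 'y) transition_system \<Rightarrow>
   ('z, 'w, 'y) transition_system \<Rightarrow> bool" where
  "approx_bisimilar \<epsilon> d S T \<longleftrightarrow>
     metric_system S d \<and> metric_system T d \<and> sys_outputs S = sys_outputs T \<and>
     (\<exists>R. approx_bisimulation \<epsilon> d S T R \<and>
          R `` sys_states S = sys_states T \<and> R\<inverse> `` sys_states T = sys_states S)"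


subsection \<open>Systems associated with a network\<close>

text \<open>
  In the transition relations below the successor is not forced to be a state; that it is one is
  part of \<open>is_system\<close>.  A label consists of the states of the other subsystems and the external
  inputs; \<open>override_on w x I\<close> is the joint state with components \<open>x\<close> in \<open>I\<close> and \<open>w\<close> elsewhere.
\<close>

definition component_system ::
  "network \<Rightarrow> nat set \<Rightarrow>
   (nat \<Rightarrow> real vec, (nat \<Rightarrow> real vec) \<times> (nat \<Rightarrow> real vec), nat \<Rightarrow> real vec) transition_system" where
  "component_system \<Sigma> I =
     \<lparr> sys_states = Pi\<^sub>E I (state_set \<Sigma>),
       sys_inputs = Pi\<^sub>E (vertices \<Sigma> - I) (state_set \<Sigma>) \<times> Pi\<^sub>E I (input_set \<Sigma>),
       sys_trans = {(x, (w, \<omega>), x').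
          x \<in> Pi\<^sub>E I (state_set \<Sigma>) \<and>
          w \<in> Pi\<^sub>E (vertices \<Sigma> - I) (state_set \<Sigma>) \<and>
          \<omega> \<in> Pi\<^sub>E I (input_set \<Sigma>) \<and>
          x' = joint_dyn \<Sigma> I (override_on w x I) \<omega>},
       sys_outputs = Pi\<^sub>E I (state_set \<Sigma>),
       sys_out = (\<lambda>x. x) \<rparr>"

definition quantized_system ::
  "network \<Rightarrow> (nat \<Rightarrow> real) \<Rightarrow> nat \<Rightarrow>
   (real vec, (nat \<Rightarrow> real vec) \<times> real vec, real vec) transition_system" where
  "quantized_system \<Sigma> \<eta> i =
     \<lparr> sys_states = lattice_in (\<eta> i) (state_set \<Sigma> i),
       sys_inputs = (\<Pi>\<^sub>E j\<in>vertices \<Sigma> - {i}. lattice_in (\<eta> j) (state_set \<Sigma> j)) \<times>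
                    lattice_in (\<eta> i) (input_set \<Sigma> i),
       sys_trans = {(x, (w, u), x').
          x \<in> lattice_in (\<eta> i) (state_set \<Sigma> i) \<and>
          w \<in> (\<Pi>\<^sub>E j\<in>vertices \<Sigma> - {i}. lattice_in (\<eta> j) (state_set \<Sigma> j)) \<and>
          u \<in> lattice_in (\<eta> i) (input_set \<Sigma> i) \<and>
          x' = quantize (\<eta> i) (dyn \<Sigma> i (w(i := x)) u)},
       sys_outputs = state_set \<Sigma> i,
       sys_out = (\<lambda>x. x) \<rparr>"

definition quantized_composition ::
  "network \<Rightarrow> (nat \<Rightarrow> real) \<Rightarrow> nat set \<Rightarrow>
   (nat \<Rightarrow> real vec, (nat \<Rightarrow> real vec) \<times> (nat \<Rightarrow> real vec), nat \<Rightarrow> real vec) transition_system" where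
  "quantized_composition \<Sigma> \<eta> I =
     \<lparr> sys_states = (\<Pi>\<^sub>E i\<in>I. lattice_in (\<eta> i) (state_set \<Sigma> i)),
       sys_inputs = (\<Pi>\<^sub>E j\<in>vertices \<Sigma> - I. lattice_in (\<eta> j) (state_set \<Sigma> j)) \<times>
                    (\<Pi>\<^sub>E i\<in>I. lattice_in (\<eta> i) (input_set \<Sigma> i)),
       sys_trans = {(x, (w, \<omega>), x').
          x \<in> (\<Pi>\<^sub>E i\<in>I. lattice_in (\<eta> i) (state_set \<Sigma> i)) \<and>
          w \<in> (\<Pi>\<^sub>E j\<in>vertices \<Sigma> - I. lattice_in (\<eta> j) (state_set \<Sigma> j)) \<and>
          \<omega> \<in> (\<Pi>\<^sub>E i\<in>I. lattice_in (\<eta> i) (input_set \<Sigma> i)) \<and>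
          x' \<in> extensional I \<and>
          (\<forall>i\<in>I. (x i, (restrict (override_on w x I) (vertices \<Sigma> - {i}), \<omega> i), x' i)
                   \<in> sys_trans (quantized_system \<Sigma> \<eta> i))},
       sys_outputs = Pi\<^sub>E I (state_set \<Sigma>),
       sys_out = (\<lambda>x. x) \<rparr>"


subsection \<open>Small-gain data\<close>

text \<open>The vertices of the component are listed as \<open>vs\<close>; matrix indices start at \<open>0\<close>.\<close>

definition gain_diag :: "nat list \<Rightarrow> (nat \<Rightarrow> real) \<Rightarrow> real mat" where
  "gain_diag vs a = mat_diag (length vs) (\<lambda>p. a (vs ! p))"

definition gain_offdiag :: "nat list \<Rightarrow> (nat \<Rightarrow> nat \<Rightarrow> real) \<Rightarrow> real mat" where
  "gain_offdiag vs c =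
     Matrix.mat (length vs) (length vs) (\<lambda>(p, q). if p = q then 0 else c (vs ! p) (vs ! q))"

definition real_spectral_radius :: "real mat \<Rightarrow> real" where
  "real_spectral_radius M = spectral_radius (map_mat complex_of_real M)"

definition inverse_matrix :: "real mat \<Rightarrow> real mat" where
  "inverse_matrix M = the (mat_inverse M)"

text \<open>The row vector \<open>v\<^sup>T M\<close>.\<close>

definition row_vec_mult :: "real vec \<Rightarrow> real mat \<Rightarrow> real vec" where
  "row_vec_mult v M = transpose_mat M *\<^sub>v v"

definition positive_vec :: "real vec \<Rightarrow> bool" where
  "positive_vec v \<longleftrightarrow> (\<forall>p<dim_vec v. vec_index v p > 0)"

definition weighted_sum ::
  "nat set \<Rightarrow> (nat \<Rightarrow> real) \<Rightarrow> (nat \<Rightarrow> real vec \<Rightarrow> real vec \<Rightarrow> real) \<Rightarrow>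
   (nat \<Rightarrow> real vec) \<Rightarrow> (nat \<Rightarrow> real vec) \<Rightarrow> real" where
  "weighted_sum I lam V \<xi> \<xi>' = (\<Sum>i\<in>I. lam i * V i (\<xi> i) (\<xi>' i))"

end

theory Submission
  imports Defs
begin

text \<open>
  Write \<open>v\<^sub>i = V\<^sub>i (x\<^sub>i, x\<^sub>i')\<close>.  Since \<open>\<parallel>x\<^sub>j - x\<^sub>j'\<parallel>\<close> is at most \<open>al\<^sub>j\<close> inverse of \<open>v\<^sub>j\<close>, the
  small-gain data turn the interconnection terms inside the component into multiples of the decay
  terms: summing the dissipation inequalities with weights \<open>\<lambda>\<^sub>i\<close> and exchanging the order of
  summation leaves \<open>- \<Sum>\<^sub>j \<mu>\<^sub>j g\<^sub>j (v\<^sub>j)\<close>, where \<open>\<mu>\<close> is the vector \<open>\<lambda>\<^sup>T (A - C)\<close>, positive by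
  hypothesis (\<open>sum_weighted_gains_le\<close>).  Such a sum dominates a class \<open>\<K>\<^sub>\<infinity>\<close> function of
  \<open>\<Sum>\<^sub>i \<lambda>\<^sub>i v\<^sub>i\<close> (\<open>class_Kinf_decay_of_weighted_sum\<close>); the terms from outside the component and
  from the inputs are collected block by block into the remaining gains
  (\<open>weighted_sum_dISS_lyapunov\<close>).

  For the abstraction the relation is the sublevel set \<open>W (x, z) \<le> \<alpha> \<epsilon>\<close> of the Lyapunov function
  \<open>W\<close>.  Along one step in which the two systems get external states and inputs that differ by at
  most the grid size, and in which the first successor is moved to the grid afterwards, the value
  \<open>s = W (x, z)\<close> becomes at most \<open>s - \<rho> s + d\<close>, and the condition on the grid size says
  \<open>d \<le> \<rho> (\<alpha> \<epsilon>)\<close>.  To conclude that the new value is again at most \<open>\<alpha> \<epsilon>\<close>, the map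
  \<open>s \<mapsto> s - \<rho> s\<close> has to be nondecreasing.  An arbitrary decay rate need not have this property, but
  each one has a class \<open>\<K>\<^sub>\<infinity>\<close> minorant that does (\<open>class_Kinf_slow_minorant\<close>), and the decay rate
  of the component is chosen to be of this kind.  The bisimulation is then
  \<open>dISS_lyapunov_imp_approx_bisimilar\<close>.
\<close>

section \<open>Comparison functions\<close>

lemma class_K_zero: "class_K \<gamma> \<Longrightarrow> \<gamma> 0 = 0"
  by (simp add: class_K_def)

lemma class_K_less_iff:
  assumes "class_K \<gamma>" "0 \<le> s" "0 \<le> t"
  shows "\<gamma> s < \<gamma> t \<longleftrightarrow> s < t"
  using assms by (intro strict_mono_on_less[of "{0..}"]) (auto simp: class_K_def)

lemma class_K_le_iff:
  assumes "class_K \<gamma>" "0 \<le> s" "0 \<le> t"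
  shows "\<gamma> s \<le> \<gamma> t \<longleftrightarrow> s \<le> t"
  using class_K_less_iff[of \<gamma> t s] assms by (metis not_less)

lemma class_K_nonneg: "class_K \<gamma> \<Longrightarrow> 0 \<le> s \<Longrightarrow> 0 \<le> \<gamma> s"
  using class_K_le_iff[of \<gamma> 0 s] class_K_zero[of \<gamma>] by simp

lemma class_Kinf_imp_class_K: "class_Kinf \<gamma> \<Longrightarrow> class_K \<gamma>"
  by (simp add: class_Kinf_def)

lemma class_K_scale:
  assumes "class_K \<gamma>" "0 < m" "0 < b"
  shows "class_K (\<lambda>s. m * \<gamma> (b * s))"
proof -
  have "continuous_on {0..} (\<lambda>s. \<gamma> (b * s))"
    using assms
    by (intro continuous_on_compose2[of "{0..}" \<gamma> "{0..}" "\<lambda>s. b * s"] continuous_on_mult_left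
        continuous_on_id) (auto simp: class_K_def)
  moreover have "strict_mono_on {0..} (\<lambda>s. m * \<gamma> (b * s))"
    using assms by (auto simp: class_K_less_iff[of \<gamma>] intro!: strict_mono_onI)
  ultimately show ?thesis
    using assms by (auto simp: class_K_def intro: continuous_on_mult_left)
qed

lemma class_Kinf_scale:
  assumes "class_Kinf \<gamma>" "0 < m" "0 < b"
  shows "class_Kinf (\<lambda>s. m * \<gamma> (b * s))"
proof -
  have "filterlim (\<lambda>s. b * s) at_top at_top"
    using assms(3) by (intro filterlim_tendsto_pos_mult_at_top[OF tendsto_const]) (auto simp: filterlim_ident)
  hence "filterlim (\<lambda>s. \<gamma> (b * s)) at_top at_top"
    using assms(1) filterlim_compose[of \<gamma> at_top at_top] by (auto simp: class_Kinf_def)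
  hence "filterlim (\<lambda>s. m * \<gamma> (b * s)) at_top at_top"
    using assms(2) by (intro filterlim_tendsto_pos_mult_at_top[OF tendsto_const]) auto
  thus ?thesis
    using class_K_scale[OF _ assms(2,3)] assms(1) by (simp add: class_Kinf_def)
qed

lemma class_K_sum:
  assumes "finite I" "I \<noteq> {}" "\<And>i. i \<in> I \<Longrightarrow> class_K (\<gamma> i)"
  shows "class_K (\<lambda>s. \<Sum>i\<in>I. \<gamma> i s)"
proof -
  have "strict_mono_on {0..} (\<lambda>s. \<Sum>i\<in>I. \<gamma> i s)"
    using assms by (auto simp: class_K_less_iff[of "\<gamma> i" for i] intro!: strict_mono_onI sum_strict_mono)
  thus ?thesis
    using assms by (auto simp: class_K_def intro!: continuous_on_sum sum.neutral)
qed

lemma class_Kinf_sum: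
  assumes "finite I" "I \<noteq> {}" "\<And>i. i \<in> I \<Longrightarrow> class_Kinf (\<gamma> i)"
  shows "class_Kinf (\<lambda>s. \<Sum>i\<in>I. \<gamma> i s)"
proof -
  obtain i where i: "i \<in> I" using assms(2) by auto
  have "eventually (\<lambda>s. \<gamma> i s \<le> (\<Sum>i\<in>I. \<gamma> i s)) at_top"
    using eventually_ge_at_top[of 0]
  proof eventually_elim
    case (elim s)
    thus ?case
      using assms i
      by (intro member_le_sum) (auto intro: class_K_nonneg[of "\<gamma> i" for i] class_Kinf_imp_class_K)
  qed
  moreover have "filterlim (\<gamma> i) at_top at_top"
    using assms(3)[OF i] by (simp add: class_Kinf_def)
  ultimately have "filterlim (\<lambda>s. \<Sum>i\<in>I. \<gamma> i s) at_top at_top"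
    by (rule filterlim_at_top_mono[rotated])
  thus ?thesis
    using assms class_K_sum[of I \<gamma>] by (auto simp: class_Kinf_def)
qed

lemma class_Kinf_min:
  assumes "class_Kinf \<gamma>" "class_Kinf \<delta>"
  shows "class_Kinf (\<lambda>s. min (\<gamma> s) (\<delta> s))"
proof -
  have "filterlim (\<lambda>s. min (\<gamma> s) (\<delta> s)) at_top at_top"
    using assms by (auto simp: class_Kinf_def filterlim_at_top eventually_conj_iff)
  moreover have "strict_mono_on {0..} (\<lambda>s. min (\<gamma> s) (\<delta> s))"
  proof (rule strict_mono_onI)
    fix s t :: real assume "s \<in> {0..}" "t \<in> {0..}" "s < t"
    hence "\<gamma> s < \<gamma> t" "\<delta> s < \<delta> t"
      using assms[THEN class_Kinf_imp_class_K] by (auto simp: class_K_less_iff[of \<gamma>] class_K_less_iff[of \<delta>])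
    thus "min (\<gamma> s) (\<delta> s) < min (\<gamma> t) (\<delta> t)" by (auto simp: min_def)
  qed
  ultimately show ?thesis
    using assms by (auto simp: class_Kinf_def class_K_def intro: continuous_on_min)
qed

lemma class_Kinf_common_lower_bound:
  assumes "finite I" "I \<noteq> {}" "\<And>i. i \<in> I \<Longrightarrow> class_Kinf (\<gamma> i)"
  shows "\<exists>\<beta>. class_Kinf \<beta> \<and> (\<forall>i\<in>I. \<forall>s\<ge>0. \<beta> s \<le> \<gamma> i s)"
  using assms
proof (induction rule: finite_ne_induct)
  case (singleton i)
  show ?case by (rule exI[of _ "\<gamma> i"]) (use singleton in auto)
next
  case (insert i J)
  then obtain \<beta> where "class_Kinf \<beta>" "\<forall>j\<in>J. \<forall>s\<ge>0. \<beta> s \<le> \<gamma> j s" by blast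
  thus ?case
    using insert.prems by (intro exI[of _ "\<lambda>s. min (\<gamma> i s) (\<beta> s)"])
      (auto intro!: class_Kinf_min simp: min_le_iff_disj)
qed

lemma class_Kinf_inverse:
  assumes "class_Kinf \<gamma>" "0 \<le> s"
  shows "0 \<le> inv_into {0..} \<gamma> s" "\<gamma> (inv_into {0..} \<gamma> s) = s"
proof -
  have "eventually (\<lambda>b. s \<le> \<gamma> b) at_top"
    using assms(1) by (auto simp: class_Kinf_def filterlim_at_top)
  hence "eventually (\<lambda>b. s \<le> \<gamma> b \<and> 0 \<le> b) at_top"
    using eventually_ge_at_top by (rule eventually_conj)
  then obtain b where b: "s \<le> \<gamma> b" "0 \<le> b"
    using eventually_happens'[OF trivial_limit_at_top_linorder] by blast
  have "continuous_on {0..b} \<gamma>"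
    using assms(1) by (auto simp: class_Kinf_def class_K_def intro: continuous_on_subset)
  then obtain t where "0 \<le> t" "\<gamma> t = s"
    using IVT'[of \<gamma> 0 s b] assms b class_K_zero[OF class_Kinf_imp_class_K[OF assms(1)]] by auto
  hence "s \<in> \<gamma> ` {0..}" by auto
  thus "0 \<le> inv_into {0..} \<gamma> s" "\<gamma> (inv_into {0..} \<gamma> s) = s"
    using inv_into_into[of s \<gamma> "{0..}"] f_inv_into_f[of s \<gamma> "{0..}"] by auto
qed

text \<open>
  The minorant is the infimal convolution of \<open>\<rho>\<close> with the identity,
  \<open>s \<mapsto> min {\<rho> t + (s - t) | 0 \<le> t \<le> s}\<close>, the largest minorant of \<open>\<rho>\<close> whose slope nowhere
  exceeds \<open>1\<close>.  It stays of class \<open>\<K>\<^sub>\<infinity>\<close>, because \<open>\<rho>\<close> and the identity are.  The slope bound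
  makes the comparison system \<open>s \<mapsto> s - \<beta> s + d\<close> monotone in \<open>s\<close>, which is what keeps sublevel
  sets invariant in discrete time.
\<close>

lemma class_Kinf_slow_minorant:
  assumes "class_Kinf \<rho>"
  shows "\<exists>\<beta>. class_Kinf \<beta> \<and> (\<forall>s\<ge>0. \<beta> s \<le> \<rho> s) \<and>
    (\<forall>s t. 0 \<le> s \<longrightarrow> s \<le> t \<longrightarrow> \<beta> t - \<beta> s \<le> t - s)"
proof -
  have K: "class_K \<rho>" using assms by (rule class_Kinf_imp_class_K)
  define h where "h t = \<rho> t - t" for t
  \<comment> \<open>Minimizing \<open>\<rho> t + (s - t)\<close> over \<open>t\<close> amounts to minimizing \<open>h\<close>, whatever \<open>s\<close> is.\<close>
  have "\<exists>m\<in>{0..s}. \<forall>t\<in>{0..s}. h m \<le> h t" if "0 \<le> s" for s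
    using K that unfolding h_def class_K_def
    by (intro continuous_attains_inf) (auto intro!: continuous_on_diff continuous_on_id elim: continuous_on_subset)
  hence "\<forall>s\<in>{0..}. \<exists>m. m \<in> {0..s} \<and> (\<forall>t\<in>{0..s}. h m \<le> h t)"
    by (simp add: Bex_def)
  from bchoice[OF this] obtain m
    where "\<forall>s\<in>{0..}. m s \<in> {0..s} \<and> (\<forall>t\<in>{0..s}. h (m s) \<le> h t)" ..
  hence m: "0 \<le> s \<Longrightarrow> m s \<in> {0..s}"
    and hm: "0 \<le> s \<Longrightarrow> t \<in> {0..s} \<Longrightarrow> h (m s) \<le> h t" for s t
    by auto
  define \<beta> where "\<beta> s = h (m s) + s" for s
  have below: "\<beta> s \<le> \<rho> s" if "0 \<le> s" for s
    using hm[of s s] that by (simp add: \<beta>_def h_def)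
  have slow: "\<beta> t - \<beta> s \<le> t - s" if "0 \<le> s" "s \<le> t" for s t
    using hm[of t "m s"] m[of s] that by (simp add: \<beta>_def)
  have mono: "\<beta> s < \<beta> t" if "0 \<le> s" "s < t" for s t
  proof (cases "m t \<le> s")
    case True
    thus ?thesis using hm[of s "m t"] m[of t] that by (simp add: \<beta>_def)
  next
    case False
    hence "\<beta> s < \<rho> (m t)"
      using below[of s] class_K_less_iff[OF K, of s "m t"] that by force
    thus ?thesis using m[of t] that by (simp add: \<beta>_def h_def)
  qed
  have "\<beta> 0 = 0"
    using m[of 0] class_K_zero[OF K] by (simp add: \<beta>_def h_def)
  moreover have "strict_mono_on {0..} \<beta>"
    using mono by (auto intro!: strict_mono_onI)
  moreover have "continuous_on {0..} \<beta>"
  proof -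
    have *: "\<bar>\<beta> s - \<beta> t\<bar> \<le> \<bar>s - t\<bar>" if "0 \<le> s" "0 \<le> t" for s t
      using slow[of s t] slow[of t s] mono[of s t] mono[of t s] that
      by (cases s t rule: linorder_cases) auto
    show ?thesis
      unfolding continuous_on_def tendsto_iff eventually_at dist_real_def
    proof (intro ballI allI impI)
      fix s e :: real assume "s \<in> {0..}" "0 < e"
      thus "\<exists>d>0. \<forall>t\<in>{0..}. t \<noteq> s \<and> \<bar>t - s\<bar> < d \<longrightarrow> \<bar>\<beta> t - \<beta> s\<bar> < e"
        using * by (intro exI[of _ e]) (auto intro: le_less_trans)
    qed
  qed
  \<comment> \<open>If the minimizer lies below \<open>s/2\<close>, the identity contributes \<open>s/2\<close>; otherwise \<open>\<rho>\<close>
    contributes \<open>\<rho> (s/2)\<close>.\<close>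
  moreover have "filterlim \<beta> at_top at_top"
  proof (rule filterlim_at_top_mono)
    have "class_Kinf (\<lambda>s. min (1 * \<rho> (1/2 * s)) (1/2 * s))"
    proof -
      have "class_Kinf (\<lambda>s. s)"
        by (auto simp: class_Kinf_def class_K_def filterlim_ident strict_mono_on_def)
      from class_Kinf_scale[OF this, of "1/2" 1] show ?thesis
        using assms by (intro class_Kinf_min class_Kinf_scale) auto
    qed
    thus "filterlim (\<lambda>s. min (\<rho> (s/2)) (s/2)) at_top at_top"
      by (simp add: class_Kinf_def)
    show "eventually (\<lambda>s. min (\<rho> (s/2)) (s/2) \<le> \<beta> s) at_top"
      using eventually_ge_at_top[of 0]
    proof eventually_elim
      case (elim s)
      show ?case
      proof (cases "m s \<le> s/2")
        case True
        thus ?thesis using m[OF elim] class_K_nonneg[OF K, of "m s"] by (simp add: \<beta>_def h_def)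
      next
        case False
        hence "\<rho> (s/2) \<le> \<rho> (m s)" using elim class_K_le_iff[OF K, of "s/2" "m s"] by simp
        thus ?thesis using m[OF elim] by (auto simp: \<beta>_def h_def min_le_iff_disj)
      qed
    qed
  qed
  ultimately show ?thesis
    using below slow by (intro exI[of _ \<beta>]) (auto simp: class_Kinf_def class_K_def)
qed

text \<open>
  At least one of the \<open>n\<close> terms of \<open>\<Sum> \<lambda>\<^sub>i v\<^sub>i\<close> reaches the average, so the weighted decay rates
  dominate \<open>min\<^sub>i \<mu>\<^sub>i g\<^sub>i (s / (n \<lambda>\<^sub>i))\<close> at \<open>s = \<Sum> \<lambda>\<^sub>i v\<^sub>i\<close>.
\<close>

lemma class_Kinf_decay_of_weighted_sum:
  fixes lam \<mu> :: "'i \<Rightarrow> real"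
  assumes I: "finite I" "I \<noteq> {}"
    and g: "\<And>i. i \<in> I \<Longrightarrow> class_Kinf (g i)"
    and pos: "\<And>i. i \<in> I \<Longrightarrow> 0 < lam i" "\<And>i. i \<in> I \<Longrightarrow> 0 < \<mu> i"
  shows "\<exists>\<rho>. class_Kinf \<rho> \<and> (\<forall>s t. 0 \<le> s \<longrightarrow> s \<le> t \<longrightarrow> \<rho> t - \<rho> s \<le> t - s) \<and>
    (\<forall>v. (\<forall>i\<in>I. 0 \<le> v i) \<longrightarrow> \<rho> (\<Sum>i\<in>I. lam i * v i) \<le> (\<Sum>i\<in>I. \<mu> i * g i (v i)))"
proof -
  define n where "n = real (card I)"
  have n: "0 < n" using I by (simp add: n_def card_gt_0_iff)
  have "\<exists>\<beta>. class_Kinf \<beta> \<and> (\<forall>i\<in>I. \<forall>s\<ge>0. \<beta> s \<le> \<mu> i * g i (1 / (n * lam i) * s))"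
    using I g pos n by (intro class_Kinf_common_lower_bound class_Kinf_scale) auto
  then obtain \<beta> where \<beta>: "class_Kinf \<beta>"
      "\<And>i s. i \<in> I \<Longrightarrow> 0 \<le> s \<Longrightarrow> \<beta> s \<le> \<mu> i * g i (s / (n * lam i))"
    by auto
  from class_Kinf_slow_minorant[OF \<beta>(1)] obtain \<rho> where \<rho>: "class_Kinf \<rho>"
      "\<And>s. 0 \<le> s \<Longrightarrow> \<rho> s \<le> \<beta> s" "\<forall>s t. 0 \<le> s \<longrightarrow> s \<le> t \<longrightarrow> \<rho> t - \<rho> s \<le> t - s"
    by blast
  have "\<rho> (\<Sum>i\<in>I. lam i * v i) \<le> (\<Sum>i\<in>I. \<mu> i * g i (v i))" if v: "\<forall>i\<in>I. 0 \<le> v i" for v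
  proof -
    define s where "s = (\<Sum>i\<in>I. lam i * v i)"
    have s: "0 \<le> s" unfolding s_def using v pos by (auto intro!: sum_nonneg mult_nonneg_nonneg less_imp_le[of 0 "lam i" for i])
    obtain i where i: "i \<in> I" "s / n \<le> lam i * v i"
    proof (rule ccontr)
      assume "\<not> thesis"
      hence "(\<Sum>i\<in>I. lam i * v i) < (\<Sum>i\<in>I. s / n)"
        using I that by (intro sum_strict_mono) force+
      thus False using n by (simp add: s_def[symmetric] n_def)
    qed
    hence "s / (n * lam i) \<le> v i" using pos(1)[OF i(1)] n by (simp add: field_simps)
    hence "g i (s / (n * lam i)) \<le> g i (v i)"
      using class_K_le_iff[of "g i" "s / (n * lam i)" "v i"] g[OF i(1)] i v s n pos(1)[OF i(1)]
      by (auto simp: class_Kinf_imp_class_K)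
    hence "\<mu> i * g i (s / (n * lam i)) \<le> \<mu> i * g i (v i)"
      using pos(2)[OF i(1)] by simp
    hence "\<rho> s \<le> \<mu> i * g i (v i)"
      using \<rho>(2)[OF s] \<beta>(2)[OF i(1) s] by linarith
    also have "\<dots> \<le> (\<Sum>i\<in>I. \<mu> i * g i (v i))"
      using I i g pos v
      by (intro member_le_sum)
        (auto intro!: mult_nonneg_nonneg less_imp_le[of 0 "\<mu> i" for i]
          class_K_nonneg[of "g i" for i] class_Kinf_imp_class_K)
    finally show ?thesis by (simp add: s_def)
  qed
  thus ?thesis using \<rho> by blast
qed

section \<open>The infinity norm on vectors and families of vectors\<close>

lemma inf_norm_le_iff: "inf_norm v \<le> r \<longleftrightarrow> 0 \<le> r \<and> (\<forall>l<dim_vec v. \<bar>v $ l\<bar> \<le> r)"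
  unfolding inf_norm_def by (subst Max_le_iff) auto

lemma inf_norm_nonneg: "0 \<le> inf_norm v"
  using inf_norm_le_iff[of v "inf_norm v"] by simp

lemma inf_dist_nonneg: "0 \<le> inf_dist x y"
  by (simp add: inf_dist_def inf_norm_nonneg)

lemma inf_dist_le_iff:
  assumes "y \<in> carrier_vec d"
  shows "inf_dist x y \<le> r \<longleftrightarrow> 0 \<le> r \<and> (\<forall>l<d. \<bar>x $ l - y $ l\<bar> \<le> r)"
  using assms by (auto simp: inf_dist_def inf_norm_le_iff)

lemma inf_dist_self: "inf_dist x x = 0"
  using inf_dist_le_iff[of x "dim_vec x" x 0] inf_dist_nonneg[of x x] by simp

lemma inf_dist_commute:
  assumes "x \<in> carrier_vec d" "y \<in> carrier_vec d"
  shows "inf_dist x y = inf_dist y x"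
proof -
  have "inf_dist x y \<le> r \<longleftrightarrow> inf_dist y x \<le> r" for r
    using assms by (simp add: inf_dist_le_iff[of _ d] abs_minus_commute)
  thus ?thesis by (metis order.refl order.antisym)
qed

lemma inf_dist_eq_0_iff:
  assumes "x \<in> carrier_vec d" "y \<in> carrier_vec d"
  shows "inf_dist x y = 0 \<longleftrightarrow> x = y"
proof
  assume "inf_dist x y = 0"
  hence "\<forall>l<d. x $ l = y $ l" using inf_dist_le_iff[OF assms(2), of x 0] by auto
  thus "x = y" using assms by auto
qed (simp add: inf_dist_self)

lemma inf_dist_triangle:
  assumes "x \<in> carrier_vec d" "y \<in> carrier_vec d" "z \<in> carrier_vec d"
  shows "inf_dist x z \<le> inf_dist x y + inf_dist y z"
proof -
  have "\<bar>x $ l - z $ l\<bar> \<le> inf_dist x y + inf_dist y z" if "l < d" for l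
    using inf_dist_le_iff[OF assms(2), of x "inf_dist x y"]
      inf_dist_le_iff[OF assms(3), of y "inf_dist y z"] that by fastforce
  thus ?thesis
    using assms by (simp add: inf_dist_le_iff[of z d] inf_dist_nonneg)
qed

lemma fam_dist_le_iff:
  assumes "finite I" "I \<noteq> {}"
  shows "fam_dist I x y \<le> r \<longleftrightarrow> (\<forall>i\<in>I. inf_dist (x i) (y i) \<le> r)"
  using assms unfolding fam_dist_def by (subst Max_le_iff) auto

lemma inf_dist_le_fam_dist: "finite I \<Longrightarrow> i \<in> I \<Longrightarrow> inf_dist (x i) (y i) \<le> fam_dist I x y"
  unfolding fam_dist_def by (rule Max_ge) auto

lemma fam_dist_nonneg:
  assumes "finite I" "I \<noteq> {}"
  shows "0 \<le> fam_dist I x y"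
proof -
  obtain i where "i \<in> I" using assms by auto
  thus ?thesis
    using inf_dist_le_fam_dist[OF assms(1), of i x y] inf_dist_nonneg[of "x i" "y i"] by simp
qed

lemma fam_dist_self: "finite I \<Longrightarrow> I \<noteq> {} \<Longrightarrow> fam_dist I x x = 0"
  using fam_dist_le_iff[of I x x 0] fam_dist_nonneg[of I x x] by (simp add: inf_dist_self)

lemma fam_dist_attained:
  assumes "finite I" "I \<noteq> {}"
  shows "\<exists>i\<in>I. fam_dist I x y = inf_dist (x i) (y i)"
proof -
  have "fam_dist I x y \<in> (\<lambda>i. inf_dist (x i) (y i)) ` I"
    unfolding fam_dist_def using assms by (intro Max_in) auto
  thus ?thesis by auto
qed

lemma fam_dist_restrict: "fam_dist I (restrict x I) (restrict y I) = fam_dist I x y"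
  unfolding fam_dist_def by (intro arg_cong[where f = Max] image_cong) auto

lemma is_metric_on_fam_dist:
  assumes I: "finite I" "I \<noteq> {}"
    and S: "\<And>i. i \<in> I \<Longrightarrow> S i \<subseteq> carrier_vec (d i)"
  shows "is_metric_on (Pi\<^sub>E I S) (fam_dist I)"
  unfolding is_metric_on_def
proof (intro ballI conjI)
  fix x y z assume x: "x \<in> Pi\<^sub>E I S" and y: "y \<in> Pi\<^sub>E I S" and z: "z \<in> Pi\<^sub>E I S"
  have car: "x i \<in> carrier_vec (d i)" "y i \<in> carrier_vec (d i)" "z i \<in> carrier_vec (d i)"
    if "i \<in> I" for i
    using S[OF that] x y z that by (auto simp: PiE_iff)
  show "0 \<le> fam_dist I x y" using I by (rule fam_dist_nonneg)
  show "fam_dist I x y = fam_dist I y x"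
    unfolding fam_dist_def
    by (intro arg_cong[where f = Max] image_cong) (auto intro: inf_dist_commute car)
  show "fam_dist I x y = 0 \<longleftrightarrow> x = y"
  proof
    assume "fam_dist I x y = 0"
    hence "inf_dist (x i) (y i) = 0" if "i \<in> I" for i
      using inf_dist_le_fam_dist[OF I(1) that, of x y] inf_dist_nonneg[of "x i" "y i"] by simp
    thus "x = y" using x y car inf_dist_eq_0_iff by (intro PiE_ext[of x I S y]) blast+
  qed (simp add: fam_dist_self I)
  show "fam_dist I x z \<le> fam_dist I x y + fam_dist I y z"
    unfolding fam_dist_le_iff[OF I]
  proof
    fix i assume i: "i \<in> I"
    thus "inf_dist (x i) (z i) \<le> fam_dist I x y + fam_dist I y z"
      using inf_dist_triangle[OF car[OF i]] inf_dist_le_fam_dist[OF I(1) i, of x y]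
        inf_dist_le_fam_dist[OF I(1) i, of y z] by linarith
  qed
qed

lemma inf_dist_quantize_le:
  assumes "0 < \<eta>"
  shows "inf_dist x (quantize \<eta> x) \<le> \<eta>"
proof -
  have "\<bar>t - \<eta> * of_int \<lceil>t / \<eta>\<rceil>\<bar> \<le> \<eta>" for t
  proof -
    have "t / \<eta> \<le> of_int \<lceil>t / \<eta>\<rceil>" "of_int \<lceil>t / \<eta>\<rceil> \<le> t / \<eta> + 1" by linarith+
    from this[THEN mult_left_mono[of _ _ \<eta>]] assms
    have "t \<le> \<eta> * of_int \<lceil>t / \<eta>\<rceil>" "\<eta> * of_int \<lceil>t / \<eta>\<rceil> \<le> t + \<eta>"
      by (simp_all add: distrib_left)
    thus ?thesis by linarith
  qed
  thus ?thesis
    using assms by (subst inf_dist_le_iff[of _ "dim_vec x"]) (auto simp: quantize_def)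
qed

lemma lattice_in_subset: "lattice_in \<eta> S \<subseteq> S"
  by (auto simp: lattice_in_def)

lemma lattice_covers_family:
  assumes "\<And>i. i \<in> I \<Longrightarrow> lattice_covers (\<eta> i) (S i)" "z \<in> Pi\<^sub>E I S"
  shows "\<exists>x\<in>(\<Pi>\<^sub>E i\<in>I. lattice_in (\<eta> i) (S i)). \<forall>i\<in>I. inf_dist (z i) (x i) \<le> \<eta> i"
proof -
  have "\<forall>i\<in>I. \<exists>y. y \<in> lattice_in (\<eta> i) (S i) \<and> inf_dist (z i) y \<le> \<eta> i"
    using assms unfolding lattice_covers_def PiE_iff by blast
  from bchoice[OF this] obtain x
    where "\<forall>i\<in>I. x i \<in> lattice_in (\<eta> i) (S i) \<and> inf_dist (z i) (x i) \<le> \<eta> i" ..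
  thus ?thesis by (intro bexI[of _ "restrict x I"]) auto
qed

section \<open>The partition into strongly connected components\<close>

lemma wf_digraph_net_graph: "wf_digraph (net_graph \<Sigma>)"
  by unfold_locales (auto simp: net_graph_def)

lemma verts_net_graph: "verts (net_graph \<Sigma>) = vertices \<Sigma>"
  by (simp add: net_graph_def)

lemma sccs_verts_partition:
  assumes "wf_digraph G" and "bij_betw P J (pre_digraph.sccs_verts G)"
  shows "\<And>j. j \<in> J \<Longrightarrow> P j \<noteq> {}" "(\<Union>j\<in>J. P j) = verts G" "disjoint_family_on P J"
proof -
  interpret wf_digraph G by fact
  have P: "P ` J = sccs_verts" "inj_on P J" using assms(2) by (auto simp: bij_betw_def)
  show "P j \<noteq> {}" if "j \<in> J" for j
  proof -
    have "P j \<in> sccs_verts" using that P(1) by auto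
    thus ?thesis by (simp add: in_sccs_verts_conv_reachable)
  qed
  show "(\<Union>j\<in>J. P j) = verts G"
    unfolding P(1) using sccs_verts_subsets scc_of_in_sccs_verts in_scc_of_self by blast
  show "disjoint_family_on P J"
    unfolding disjoint_family_on_def
  proof (intro ballI impI)
    fix i j assume "i \<in> J" "j \<in> J" "i \<noteq> j"
    hence "P i \<in> sccs_verts" "P j \<in> sccs_verts" "P i \<noteq> P j"
      using P by (auto simp: inj_on_def)
    thus "P i \<inter> P j = {}" by (rule sccs_verts_disjoint)
  qed
qed

section \<open>The weighted sum is a Lyapunov function\<close>

lemma row_vec_mult_gain_index:
  assumes vs: "distinct vs" and p: "p < length vs"
  shows "row_vec_mult (vec_of_list (map lam vs)) (gain_diag vs a - gain_offdiag vs c) $ p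
    = lam (vs ! p) * a (vs ! p) - (\<Sum>i\<in>set vs - {vs ! p}. lam i * c i (vs ! p))"
proof -
  define n where "n = length vs"
  have "row_vec_mult (vec_of_list (map lam vs)) (gain_diag vs a - gain_offdiag vs c) $ p
      = (\<Sum>q\<in>{..<n}. ((if q = p then a (vs ! p) else 0) - (if q = p then 0 else c (vs ! q) (vs ! p)))
          * lam (vs ! q))"
    using p unfolding row_vec_mult_def gain_diag_def gain_offdiag_def n_def
    by (auto simp: scalar_prod_def mat_diag_def lessThan_atLeast0 vec_of_list_index intro!: sum.cong)
  also have "\<dots> = (\<Sum>i\<in>set vs. ((if i = vs ! p then a (vs ! p) else 0)
      - (if i = vs ! p then 0 else c i (vs ! p))) * lam i)"
    using vs p unfolding n_def sum.reindex_bij_betw[OF bij_betw_nth[OF vs refl refl], symmetric]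
    by (auto simp: nth_eq_iff_index_eq intro!: sum.cong)
  also have "\<dots> = (\<Sum>i\<in>insert (vs ! p) (set vs - {vs ! p}). ((if i = vs ! p then a (vs ! p) else 0)
      - (if i = vs ! p then 0 else c i (vs ! p))) * lam i)"
    using p by (simp add: insert_absorb)
  also have "\<dots> = lam (vs ! p) * a (vs ! p) + (\<Sum>i\<in>set vs - {vs ! p}. - (lam i * c i (vs ! p)))"
    by (subst sum.insert) (auto intro!: sum.cong)
  finally show ?thesis by (simp add: sum_negf)
qed

text \<open>
  Exchanging the order of summation collects, for each \<open>j\<close>, the decay of the \<open>j\<close>-th term and its
  influence on all others; the coefficient is the \<open>j\<close>-th entry of \<open>lam\<^sup>T (A - C)\<close>.
\<close>

lemma sum_weighted_gains_le:
  fixes lam a G d e :: "'i \<Rightarrow> real" and c :: "'i \<Rightarrow> 'i \<Rightarrow> real"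
  assumes I: "finite I" and lam: "\<And>i. i \<in> I \<Longrightarrow> 0 \<le> lam i"
    and d: "\<And>i. i \<in> I \<Longrightarrow> d i \<le> - a i * G i + (\<Sum>j\<in>I - {i}. c i j * G j) + e i"
  shows "(\<Sum>i\<in>I. lam i * d i)
    \<le> - (\<Sum>j\<in>I. (lam j * a j - (\<Sum>i\<in>I - {j}. lam i * c i j)) * G j) + (\<Sum>i\<in>I. lam i * e i)"
proof -
  have swap: "(\<Sum>i\<in>I. \<Sum>j\<in>I - {i}. lam i * c i j * G j) = (\<Sum>j\<in>I. \<Sum>i\<in>I - {j}. lam i * c i j * G j)"
  proof -
    have "(\<Sum>i\<in>I. \<Sum>j\<in>I - {i}. lam i * c i j * G j)
        = (\<Sum>i\<in>I. \<Sum>j\<in>{j. j \<in> I \<and> i \<noteq> j}. lam i * c i j * G j)"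
      by (intro sum.cong) auto
    also have "\<dots> = (\<Sum>j\<in>I. \<Sum>i\<in>{i. i \<in> I \<and> i \<noteq> j}. lam i * c i j * G j)"
      by (rule sum.swap_restrict[OF I I])
    also have "\<dots> = (\<Sum>j\<in>I. \<Sum>i\<in>I - {j}. lam i * c i j * G j)"
      by (intro sum.cong) auto
    finally show ?thesis .
  qed
  have "(\<Sum>i\<in>I. lam i * d i)
      \<le> (\<Sum>i\<in>I. lam i * (- a i * G i + (\<Sum>j\<in>I - {i}. c i j * G j) + e i))"
    using lam d by (intro sum_mono mult_left_mono)
  also have "\<dots> = - (\<Sum>i\<in>I. lam i * a i * G i) + (\<Sum>i\<in>I. \<Sum>j\<in>I - {i}. lam i * c i j * G j)
      + (\<Sum>i\<in>I. lam i * e i)"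
    by (simp add: distrib_left right_diff_distrib sum.distrib sum_subtractf sum_distrib_left mult.assoc)
  also have "\<dots> = - (\<Sum>j\<in>I. (lam j * a j - (\<Sum>i\<in>I - {j}. lam i * c i j)) * G j)
      + (\<Sum>i\<in>I. lam i * e i)"
    unfolding swap by (simp add: left_diff_distrib sum_subtractf sum_distrib_right)
  finally show ?thesis .
qed

text \<open>
  The sets \<open>P j\<close>, \<open>j \<in> J\<close>, are meant to partition the vertices.  \<open>P k\<close> is the interconnection under
  consideration, and each other block is one disturbance, with gain \<open>\<tau> j\<close>.
\<close>

definition dISS_lyapunov ::
  "network \<Rightarrow> nat set \<Rightarrow> (nat \<Rightarrow> nat set) \<Rightarrow> nat \<Rightarrow>
   ((nat \<Rightarrow> real vec) \<Rightarrow> (nat \<Rightarrow> real vec) \<Rightarrow> real) \<Rightarrow> (real \<Rightarrow> real) \<Rightarrow> (real \<Rightarrow> real) \<Rightarrow>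
   (real \<Rightarrow> real) \<Rightarrow> (real \<Rightarrow> real) \<Rightarrow> (nat \<Rightarrow> real \<Rightarrow> real) \<Rightarrow> bool" where
  "dISS_lyapunov \<Sigma> J P k W \<alpha> \<beta> \<rho> \<sigma> \<tau> \<longleftrightarrow>
     class_Kinf \<alpha> \<and> class_Kinf \<beta> \<and> class_Kinf \<rho> \<and> class_K \<sigma> \<and> (\<forall>j\<in>J - {k}. class_K (\<tau> j)) \<and>
     (\<forall>\<xi>\<in>state_space \<Sigma> (P k). \<forall>\<xi>'\<in>state_space \<Sigma> (P k).
        \<alpha> (fam_dist (P k) \<xi> \<xi>') \<le> W \<xi> \<xi>' \<and> W \<xi> \<xi>' \<le> \<beta> (fam_dist (P k) \<xi> \<xi>')) \<and>
     (\<forall>x\<in>state_space \<Sigma> (vertices \<Sigma>). \<forall>x'\<in>state_space \<Sigma> (vertices \<Sigma>).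
      \<forall>\<omega>\<in>input_space \<Sigma> (P k). \<forall>\<omega>'\<in>input_space \<Sigma> (P k).
        W (joint_dyn \<Sigma> (P k) x \<omega>) (joint_dyn \<Sigma> (P k) x' \<omega>') - W (restrict x (P k)) (restrict x' (P k))
        \<le> - \<rho> (W (restrict x (P k)) (restrict x' (P k)))
          + (\<Sum>j\<in>J - {k}. \<tau> j (fam_dist (P j) (restrict x (P j)) (restrict x' (P j))))
          + \<sigma> (fam_dist (P k) \<omega> \<omega>'))"

text \<open>
  The term of a component that attains the maximum distance is already large enough, so a common
  minorant of the functions \<open>lam i * al i s\<close> serves as lower bound.
\<close>

lemma weighted_sum_lower_bound:
  assumes I: "finite I" "I \<noteq> {}"
    and al: "\<And>i. i \<in> I \<Longrightarrow> class_Kinf (al i)" and lam: "\<And>i. i \<in> I \<Longrightarrow> 0 < lam i"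
  shows "\<exists>\<alpha>. class_Kinf \<alpha> \<and> (\<forall>V \<xi> \<xi>'.
    (\<forall>i\<in>I. al i (inf_dist (\<xi> i) (\<xi>' i)) \<le> V i (\<xi> i) (\<xi>' i)) \<longrightarrow>
    \<alpha> (fam_dist I \<xi> \<xi>') \<le> weighted_sum I lam V \<xi> \<xi>')"
proof -
  have "\<exists>\<alpha>. class_Kinf \<alpha> \<and> (\<forall>i\<in>I. \<forall>s\<ge>0. \<alpha> s \<le> lam i * al i (1 * s))"
    using I al lam by (intro class_Kinf_common_lower_bound class_Kinf_scale) auto
  then obtain \<alpha> where \<alpha>: "class_Kinf \<alpha>" "\<forall>i\<in>I. \<forall>s\<ge>0. \<alpha> s \<le> lam i * al i s"
    by auto
  have "\<alpha> (fam_dist I \<xi> \<xi>') \<le> weighted_sum I lam V \<xi> \<xi>'"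
    if V: "\<forall>i\<in>I. al i (inf_dist (\<xi> i) (\<xi>' i)) \<le> V i (\<xi> i) (\<xi>' i)" for V \<xi> \<xi>'
  proof -
    have nonneg: "0 \<le> V i (\<xi> i) (\<xi>' i)" if "i \<in> I" for i
      using V that class_K_nonneg[OF class_Kinf_imp_class_K[OF al[OF that]] inf_dist_nonneg]
      by (meson order_trans)
    obtain i where i: "i \<in> I" "fam_dist I \<xi> \<xi>' = inf_dist (\<xi> i) (\<xi>' i)"
      using fam_dist_attained[OF I] by blast
    have "\<alpha> (fam_dist I \<xi> \<xi>') \<le> lam i * al i (inf_dist (\<xi> i) (\<xi>' i))"
      using \<alpha>(2) i by (simp add: inf_dist_nonneg)
    also have "\<dots> \<le> lam i * V i (\<xi> i) (\<xi>' i)"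
      using V lam i by simp
    also have "\<dots> \<le> weighted_sum I lam V \<xi> \<xi>'"
      unfolding weighted_sum_def using I i lam nonneg
      by (intro member_le_sum) (auto intro!: mult_nonneg_nonneg simp: less_imp_le)
    finally show ?thesis .
  qed
  thus ?thesis using \<alpha>(1) by blast
qed

text \<open>
  A bound by the Lyapunov value \<open>v\<close> instead of the distance \<open>r\<close> makes the interconnection terms
  comparable with the decay rates.
\<close>

lemma gain_le_lyapunov_value:
  assumes al: "class_Kinf al" and \<gamma>: "class_K \<gamma>"
    and le: "\<forall>s\<ge>0. \<gamma> (inv_into {0..} al s) \<le> b * g s"
    and r: "0 \<le> r" "al r \<le> v"
  shows "\<gamma> r \<le> b * g v"
proof -
  have v: "0 \<le> v" using r class_K_nonneg[OF class_Kinf_imp_class_K[OF al] r(1)] by simp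
  note inv = class_Kinf_inverse[OF al v]
  have "r \<le> inv_into {0..} al v"
    using class_K_le_iff[OF class_Kinf_imp_class_K[OF al] r(1) inv(1)] inv(2) r(2) by simp
  hence "\<gamma> r \<le> \<gamma> (inv_into {0..} al v)"
    using class_K_le_iff[OF \<gamma> r(1) inv(1)] by simp
  thus ?thesis using le v by force
qed

text \<open>
  The influence of the vertices outside \<open>P k\<close> is grouped by blocks: in the gain of block \<open>j\<close> every
  single distance is replaced by the maximum over the block, so this gain is the sum of all
  weighted \<open>sigx i l\<close> with \<open>i \<in> P k\<close> and \<open>l \<in> P j\<close>.  The slope bound on the decay rate is not part of
  the Lyapunov property; it is what makes sublevel sets invariant later on.
\<close>

lemma weighted_sum_dISS_lyapunov:
  fixes \<Sigma> :: network
  assumes J: "finite J" "k \<in> J"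
    and P: "\<And>j. j \<in> J \<Longrightarrow> P j \<noteq> {}" "(\<Union>j\<in>J. P j) = vertices \<Sigma>" "disjoint_family_on P J"
    and Kinf: "\<And>i. i \<in> vertices \<Sigma> \<Longrightarrow> class_Kinf (al i)" "\<And>i. i \<in> vertices \<Sigma> \<Longrightarrow> class_Kinf (au i)"
    and K: "\<And>i. i \<in> vertices \<Sigma> \<Longrightarrow> class_K (sig i)"
      "\<And>i j. i \<in> vertices \<Sigma> \<Longrightarrow> j \<in> vertices \<Sigma> \<Longrightarrow> j \<noteq> i \<Longrightarrow> class_K (sigx i j)"
    and bounds: "\<And>i x x'. i \<in> vertices \<Sigma> \<Longrightarrow> x \<in> carrier_vec (state_dim \<Sigma> i) \<Longrightarrow>
        x' \<in> carrier_vec (state_dim \<Sigma> i) \<Longrightarrow>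
        al i (inf_dist x x') \<le> V i x x' \<and> V i x x' \<le> au i (inf_dist x x')"
    and decrease: "\<And>i x x' u u'. i \<in> vertices \<Sigma> \<Longrightarrow>
        x \<in> state_space \<Sigma> (vertices \<Sigma>) \<Longrightarrow> x' \<in> state_space \<Sigma> (vertices \<Sigma>) \<Longrightarrow>
        u \<in> carrier_vec (input_dim \<Sigma> i) \<Longrightarrow> u' \<in> carrier_vec (input_dim \<Sigma> i) \<Longrightarrow>
        V i (dyn \<Sigma> i x u) (dyn \<Sigma> i x' u') - V i (x i) (x' i)
          \<le> - rho i (V i (x i) (x' i))
            + (\<Sum>j\<in>vertices \<Sigma> - {i}. sigx i j (inf_dist (x j) (x' j)))
            + sig i (inf_dist u u')"
    and g: "\<And>i. i \<in> P k \<Longrightarrow> class_Kinf (g i)"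
    and rho: "\<And>i s. i \<in> P k \<Longrightarrow> 0 \<le> s \<Longrightarrow> a i * g i s \<le> rho i s"
    and sigx: "\<And>i j. i \<in> P k \<Longrightarrow> j \<in> P k \<Longrightarrow> j \<noteq> i \<Longrightarrow>
        \<forall>s\<ge>0. sigx i j (inv_into {0..} (al j) s) \<le> c i j * g j s"
    and lam: "\<And>i. i \<in> P k \<Longrightarrow> 0 < lam i"
    and gain: "\<And>j. j \<in> P k \<Longrightarrow> (\<Sum>i\<in>P k - {j}. lam i * c i j) < lam j * a j"
  shows "\<exists>\<alpha> \<beta> \<rho> \<sigma> \<tau>. dISS_lyapunov \<Sigma> J P k (weighted_sum (P k) lam V) \<alpha> \<beta> \<rho> \<sigma> \<tau> \<and>
    (\<forall>s t. 0 \<le> s \<longrightarrow> s \<le> t \<longrightarrow> \<rho> t - \<rho> s \<le> t - s)"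
proof -
  define I where "I = P k"
  define W where "W = weighted_sum I lam V"
  define \<mu> where "\<mu> j = lam j * a j - (\<Sum>i\<in>I - {j}. lam i * c i j)" for j
  have Psub: "P j \<subseteq> vertices \<Sigma>" if "j \<in> J" for j using P(2) that by blast
  have Pfin: "finite (P j)" if "j \<in> J" for j
    using Psub[OF that] by (rule finite_subset) (simp add: vertices_def)
  have I: "finite I" "I \<noteq> {}" "I \<subseteq> vertices \<Sigma>"
    using Pfin Psub P(1) J by (auto simp: I_def)
  have Iv: "i \<in> vertices \<Sigma>" if "i \<in> I" for i using I that by blast
  have disj: "P j \<inter> I = {}" if "j \<in> J - {k}" for j
    using P(3) J that by (auto simp: disjoint_family_on_def I_def)
  have rest: "vertices \<Sigma> - I = (\<Union>j\<in>J - {k}. P j)"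
    using P(2) disj by (auto simp: I_def)
  have lam0: "0 < lam i" if "i \<in> I" for i using lam that by (simp add: I_def)

  obtain \<alpha> where \<alpha>: "class_Kinf \<alpha>" "\<And>V \<xi> \<xi>'.
      (\<forall>i\<in>I. al i (inf_dist (\<xi> i) (\<xi>' i)) \<le> V i (\<xi> i) (\<xi>' i)) \<Longrightarrow>
      \<alpha> (fam_dist I \<xi> \<xi>') \<le> weighted_sum I lam V \<xi> \<xi>'"
    using weighted_sum_lower_bound[OF I(1,2), of al lam] Kinf(1) Iv lam0 by metis

  define \<beta> where "\<beta> s = (\<Sum>i\<in>I. lam i * au i (1 * s))" for s
  have \<beta>: "class_Kinf \<beta>"
    unfolding \<beta>_def using I Kinf(2) Iv lam0 by (intro class_Kinf_sum class_Kinf_scale) auto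

  have "\<exists>\<rho>. class_Kinf \<rho> \<and> (\<forall>s t. 0 \<le> s \<longrightarrow> s \<le> t \<longrightarrow> \<rho> t - \<rho> s \<le> t - s) \<and>
    (\<forall>v. (\<forall>i\<in>I. 0 \<le> v i) \<longrightarrow> \<rho> (\<Sum>i\<in>I. lam i * v i) \<le> (\<Sum>i\<in>I. \<mu> i * g i (v i)))"
    using I g lam0 gain by (intro class_Kinf_decay_of_weighted_sum) (auto simp: \<mu>_def I_def)
  then obtain \<rho> where \<rho>: "class_Kinf \<rho>" "\<forall>s t. 0 \<le> s \<longrightarrow> s \<le> t \<longrightarrow> \<rho> t - \<rho> s \<le> t - s"
      "\<And>v. (\<forall>i\<in>I. 0 \<le> v i) \<Longrightarrow> \<rho> (\<Sum>i\<in>I. lam i * v i) \<le> (\<Sum>i\<in>I. \<mu> i * g i (v i))"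
    by blast

  define \<sigma> where "\<sigma> s = (\<Sum>i\<in>I. lam i * sig i (1 * s))" for s
  have \<sigma>: "class_K \<sigma>"
    unfolding \<sigma>_def using I K(1) Iv lam0 by (intro class_K_sum class_K_scale) auto

  define \<tau> where "\<tau> j s = (\<Sum>i\<in>I. \<Sum>l\<in>P j. lam i * sigx i l (1 * s))" for j s
  have Kx: "class_K (sigx i l)" if "i \<in> I" "j \<in> J - {k}" "l \<in> P j" for i j l
  proof -
    have "l \<in> vertices \<Sigma>" using Psub that by blast
    moreover have "l \<noteq> i" using disj[OF that(2)] that by blast
    ultimately show ?thesis using K(2)[OF Iv] that by blast
  qed
  have \<tau>: "class_K (\<tau> j)" if j: "j \<in> J - {k}" for j
    unfolding \<tau>_def
  proof (rule class_K_sum[OF I(1,2)])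
    fix i assume "i \<in> I"
    thus "class_K (\<lambda>s. \<Sum>l\<in>P j. lam i * sigx i l (1 * s))"
      using Pfin[of j] P(1)[of j] j Kx[OF _ j] lam0
      by (intro class_K_sum class_K_scale) auto
  qed

  have lower_upper: "\<alpha> (fam_dist I \<xi> \<xi>') \<le> W \<xi> \<xi>' \<and> W \<xi> \<xi>' \<le> \<beta> (fam_dist I \<xi> \<xi>')"
    if \<xi>: "\<xi> \<in> state_space \<Sigma> I" "\<xi>' \<in> state_space \<Sigma> I" for \<xi> \<xi>'
  proof
    have b: "al i (inf_dist (\<xi> i) (\<xi>' i)) \<le> V i (\<xi> i) (\<xi>' i)"
        "V i (\<xi> i) (\<xi>' i) \<le> au i (inf_dist (\<xi> i) (\<xi>' i))" if "i \<in> I" for i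
      using bounds[OF Iv[OF that], of "\<xi> i" "\<xi>' i"] \<xi> that by (auto simp: state_space_def PiE_iff)
    show "\<alpha> (fam_dist I \<xi> \<xi>') \<le> W \<xi> \<xi>'"
      unfolding W_def using b(1) by (intro \<alpha>(2)) blast
    have "V i (\<xi> i) (\<xi>' i) \<le> au i (fam_dist I \<xi> \<xi>')" if "i \<in> I" for i
      using b(2)[OF that] inf_dist_le_fam_dist[OF I(1) that, of \<xi> \<xi>']
        class_K_le_iff[OF class_Kinf_imp_class_K[OF Kinf(2)[OF Iv[OF that]]] inf_dist_nonneg
          fam_dist_nonneg[OF I(1,2)], of "\<xi> i" "\<xi>' i" \<xi> \<xi>'] by simp
    thus "W \<xi> \<xi>' \<le> \<beta> (fam_dist I \<xi> \<xi>')"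
      unfolding W_def weighted_sum_def \<beta>_def using lam0
      by (intro sum_mono mult_left_mono) (auto simp: less_imp_le)
  qed

  have decay: "W (joint_dyn \<Sigma> I x \<omega>) (joint_dyn \<Sigma> I x' \<omega>') - W (restrict x I) (restrict x' I)
      \<le> - \<rho> (W (restrict x I) (restrict x' I))
        + (\<Sum>j\<in>J - {k}. \<tau> j (fam_dist (P j) (restrict x (P j)) (restrict x' (P j))))
        + \<sigma> (fam_dist I \<omega> \<omega>')"
    if x: "x \<in> state_space \<Sigma> (vertices \<Sigma>)" "x' \<in> state_space \<Sigma> (vertices \<Sigma>)"
      and \<omega>: "\<omega> \<in> input_space \<Sigma> I" "\<omega>' \<in> input_space \<Sigma> I" for x x' \<omega> \<omega>'
  proof -
    define v where "v i = V i (x i) (x' i)" for i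
    define D where "D j = inf_dist (x j) (x' j)" for j
    define d where "d i = V i (dyn \<Sigma> i x (\<omega> i)) (dyn \<Sigma> i x' (\<omega>' i)) - v i" for i
    define e where "e i = (\<Sum>j\<in>vertices \<Sigma> - I. sigx i j (D j)) + sig i (inf_dist (\<omega> i) (\<omega>' i))" for i
    have Dnonneg: "0 \<le> D j" for j by (simp add: D_def inf_dist_nonneg)
    have alv: "al i (D i) \<le> v i" if "i \<in> I" for i
      using bounds[OF Iv[OF that], of "x i" "x' i"] x Iv[OF that]
      by (auto simp: state_space_def PiE_iff D_def v_def)
    have v: "0 \<le> v i" if "i \<in> I" for i
      using alv[OF that] class_K_nonneg[OF class_Kinf_imp_class_K[OF Kinf(1)[OF Iv[OF that]]] Dnonneg[of i]]
      by simp
    have "d i \<le> - a i * g i (v i) + (\<Sum>j\<in>I - {i}. c i j * g j (v j)) + e i" if i: "i \<in> I" for i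
    proof -
      have "d i \<le> - rho i (v i) + (\<Sum>j\<in>vertices \<Sigma> - {i}. sigx i j (D j)) + sig i (inf_dist (\<omega> i) (\<omega>' i))"
        unfolding d_def v_def D_def using \<omega> i
        by (intro decrease Iv x) (auto simp: input_space_def PiE_iff)
      also have "(\<Sum>j\<in>vertices \<Sigma> - {i}. sigx i j (D j))
          = (\<Sum>j\<in>I - {i}. sigx i j (D j)) + (\<Sum>j\<in>vertices \<Sigma> - I. sigx i j (D j))"
      proof -
        have "vertices \<Sigma> - {i} = (I - {i}) \<union> (vertices \<Sigma> - I)" using i I by blast
        moreover have "(I - {i}) \<inter> (vertices \<Sigma> - I) = {}" by blast
        ultimately show ?thesis using I(1) by (simp add: sum.union_disjoint vertices_def)
      qed
      also have "(\<Sum>j\<in>I - {i}. sigx i j (D j)) \<le> (\<Sum>j\<in>I - {i}. c i j * g j (v j))"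
      proof (rule sum_mono)
        fix j assume j: "j \<in> I - {i}"
        show "sigx i j (D j) \<le> c i j * g j (v j)"
          using j i Kinf(1) K(2) Iv alv Dnonneg sigx
          by (intro gain_le_lyapunov_value[of "al j"]) (auto simp: I_def)
      qed
      also have "- rho i (v i) \<le> - a i * g i (v i)"
        using rho[of i "v i"] v[OF i] i by (simp add: I_def)
      finally show ?thesis by (simp add: e_def)
    qed
    hence "(\<Sum>i\<in>I. lam i * d i) \<le> - (\<Sum>j\<in>I. \<mu> j * g j (v j)) + (\<Sum>i\<in>I. lam i * e i)"
      unfolding \<mu>_def using I(1) lam0 by (intro sum_weighted_gains_le) (auto simp: less_imp_le)
    moreover have "\<rho> (\<Sum>i\<in>I. lam i * v i) \<le> (\<Sum>j\<in>I. \<mu> j * g j (v j))"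
      using v by (intro \<rho>(3)) blast
    moreover have "(\<Sum>i\<in>I. lam i * e i)
        \<le> (\<Sum>j\<in>J - {k}. \<tau> j (fam_dist (P j) x x')) + \<sigma> (fam_dist I \<omega> \<omega>')"
    proof -
      have "(\<Sum>i\<in>I. lam i * (\<Sum>l\<in>vertices \<Sigma> - I. sigx i l (D l)))
          = (\<Sum>i\<in>I. lam i * (\<Sum>j\<in>J - {k}. \<Sum>l\<in>P j. sigx i l (D l)))"
        unfolding rest using J P(3) Pfin
        by (subst sum.UNION_disjoint) (auto simp: disjoint_family_on_def)
      also have "\<dots> \<le> (\<Sum>i\<in>I. lam i * (\<Sum>j\<in>J - {k}. \<Sum>l\<in>P j. sigx i l (fam_dist (P j) x x')))"
      proof (intro sum_mono mult_left_mono)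
        fix i j l assume ijl: "i \<in> I" "j \<in> J - {k}" "l \<in> P j"
        have "D l \<le> fam_dist (P j) x x'"
          unfolding D_def using ijl Pfin by (intro inf_dist_le_fam_dist) auto
        thus "sigx i l (D l) \<le> sigx i l (fam_dist (P j) x x')"
          using class_K_le_iff[OF Kx[OF ijl] Dnonneg[of l], of "fam_dist (P j) x x'"] Dnonneg[of l]
          by auto
      qed (auto simp: lam0 less_imp_le)
      also have "\<dots> = (\<Sum>j\<in>J - {k}. \<tau> j (fam_dist (P j) x x'))"
        unfolding \<tau>_def by (simp add: sum_distrib_left) (rule sum.swap)
      finally have states: "(\<Sum>i\<in>I. lam i * (\<Sum>l\<in>vertices \<Sigma> - I. sigx i l (D l)))
          \<le> (\<Sum>j\<in>J - {k}. \<tau> j (fam_dist (P j) x x'))" .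
      have "(\<Sum>i\<in>I. lam i * sig i (inf_dist (\<omega> i) (\<omega>' i))) \<le> \<sigma> (fam_dist I \<omega> \<omega>')"
        unfolding \<sigma>_def
      proof (intro sum_mono mult_left_mono)
        fix i assume i: "i \<in> I"
        show "sig i (inf_dist (\<omega> i) (\<omega>' i)) \<le> sig i (1 * fam_dist I \<omega> \<omega>')"
          using class_K_le_iff[OF K(1)[OF Iv[OF i]] inf_dist_nonneg fam_dist_nonneg[OF I(1,2)],
              of "\<omega> i" "\<omega>' i" \<omega> \<omega>'] inf_dist_le_fam_dist[OF I(1) i, of \<omega> \<omega>'] by simp
      qed (auto simp: lam0 less_imp_le)
      with states show ?thesis
        by (simp add: e_def distrib_left sum.distrib)
    qed
    moreover have "W (joint_dyn \<Sigma> I x \<omega>) (joint_dyn \<Sigma> I x' \<omega>') - W (restrict x I) (restrict x' I)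
        = (\<Sum>i\<in>I. lam i * d i)"
      unfolding W_def weighted_sum_def d_def v_def joint_dyn_def
      by (simp add: sum_subtractf right_diff_distrib)
    moreover have "W (restrict x I) (restrict x' I) = (\<Sum>i\<in>I. lam i * v i)"
      by (simp add: W_def weighted_sum_def v_def)
    ultimately show ?thesis by (simp add: fam_dist_restrict)
  qed

  have "dISS_lyapunov \<Sigma> J P k W \<alpha> \<beta> \<rho> \<sigma> \<tau>"
    unfolding dISS_lyapunov_def I_def[symmetric]
    using \<alpha>(1) \<beta> \<rho>(1) \<sigma> \<tau> lower_upper decay by blast
  thus ?thesis using \<rho>(2) unfolding W_def I_def by blast
qed

section \<open>Sublevel sets are approximate bisimulations\<close>

lemma PiE_lattice_subset: "(\<Pi>\<^sub>E i\<in>I. lattice_in (\<eta> i) (S i)) \<subseteq> Pi\<^sub>E I S"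
  by (intro PiE_mono lattice_in_subset)

text \<open>
  Composing the quantized subsystems is the same as quantizing the joint transition function: on
  \<open>I\<close> the states that a subsystem receives from its neighbours are the current states of these
  neighbours, so all components are evaluated at one joint state.
\<close>

lemma quantized_composition_trans_iff:
  assumes I: "I \<subseteq> vertices \<Sigma>"
  shows "(x, (w, \<omega>), x') \<in> sys_trans (quantized_composition \<Sigma> \<eta> I) \<longleftrightarrow>
    x \<in> (\<Pi>\<^sub>E i\<in>I. lattice_in (\<eta> i) (state_set \<Sigma> i)) \<and>
    w \<in> (\<Pi>\<^sub>E j\<in>vertices \<Sigma> - I. lattice_in (\<eta> j) (state_set \<Sigma> j)) \<and>
    \<omega> \<in> (\<Pi>\<^sub>E i\<in>I. lattice_in (\<eta> i) (input_set \<Sigma> i)) \<and>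
    x' = (\<lambda>i\<in>I. quantize (\<eta> i) (joint_dyn \<Sigma> I (override_on w x I) \<omega> i))"
    (is "?L \<longleftrightarrow> ?X \<and> ?W \<and> ?U \<and> ?E")
proof -
  have "?L \<longleftrightarrow> ?X \<and> ?W \<and> ?U \<and> x' \<in> extensional I \<and>
      (\<forall>i\<in>I. x' i = quantize (\<eta> i) (dyn \<Sigma> i (override_on w x I) (\<omega> i)))"
  proof -
    have "(x i, (restrict (override_on w x I) (vertices \<Sigma> - {i}), \<omega> i), x' i)
          \<in> sys_trans (quantized_system \<Sigma> \<eta> i)
        \<longleftrightarrow> x' i = quantize (\<eta> i) (dyn \<Sigma> i (override_on w x I) (\<omega> i))"
      if x: ?X and w: ?W and \<omega>: ?U and i: "i \<in> I" for i
    proof -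
      have "(restrict (override_on w x I) (vertices \<Sigma> - {i}))(i := x i) = override_on w x I"
        using w i I by (auto simp: fun_eq_iff override_on_def PiE_iff extensional_def)
      moreover have "restrict (override_on w x I) (vertices \<Sigma> - {i})
          \<in> (\<Pi>\<^sub>E j\<in>vertices \<Sigma> - {i}. lattice_in (\<eta> j) (state_set \<Sigma> j))"
        using x w by (auto simp: override_on_def PiE_iff)
      ultimately show ?thesis
        using x \<omega> i by (auto simp: quantized_system_def PiE_iff)
    qed
    thus ?thesis by (auto simp: quantized_composition_def)
  qed
  also have "\<dots> \<longleftrightarrow> ?X \<and> ?W \<and> ?U \<and> ?E"
    by (auto simp: joint_dyn_def intro!: extensionalityI[of x' I])
  finally show ?thesis .
qed

lemma is_system_quantized_composition:
  assumes sys: "\<And>i. i \<in> I \<Longrightarrow> is_system (quantized_system \<Sigma> \<eta> i)"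
  shows "is_system (quantized_composition \<Sigma> \<eta> I)"
  unfolding is_system_def
proof (intro conjI subsetI)
  fix t assume t: "t \<in> sys_trans (quantized_composition \<Sigma> \<eta> I)"
  obtain x w \<omega> x' where eq: "t = (x, (w, \<omega>), x')" by (cases t) auto
  have "x' i \<in> lattice_in (\<eta> i) (state_set \<Sigma> i)" if "i \<in> I" for i
  proof -
    have "(x i, (restrict (override_on w x I) (vertices \<Sigma> - {i}), \<omega> i), x' i)
        \<in> sys_trans (quantized_system \<Sigma> \<eta> i)"
      using t that by (simp add: eq quantized_composition_def)
    hence "x' i \<in> sys_states (quantized_system \<Sigma> \<eta> i)"
      using sys[OF that] unfolding is_system_def by blast
    thus ?thesis by (simp add: quantized_system_def)
  qed
  thus "t \<in> sys_states (quantized_composition \<Sigma> \<eta> I) \<times> sys_inputs (quantized_composition \<Sigma> \<eta> I) \<times>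
      sys_states (quantized_composition \<Sigma> \<eta> I)"
    using t by (simp add: eq quantized_composition_def PiE_iff)
next
  have "(\<Pi>\<^sub>E i\<in>I. lattice_in (\<eta> i) (state_set \<Sigma> i)) \<subseteq> Pi\<^sub>E I (state_set \<Sigma>)"
    by (rule PiE_lattice_subset)
  thus "sys_out (quantized_composition \<Sigma> \<eta> I)
      \<in> sys_states (quantized_composition \<Sigma> \<eta> I) \<rightarrow> sys_outputs (quantized_composition \<Sigma> \<eta> I)"
    by (auto simp: quantized_composition_def)
qed

text \<open>
  The relation is \<open>{(x, z). W x z \<le> \<alpha> \<epsilon>}\<close>.  The lower bound on \<open>W\<close> gives the precision, the upper
  bound together with the covering of the state sets relates every state to some state of the
  other system.  A transition of the quantized system is matched with the same label; a
  transition of the component is matched with a label from the grid that is within the grid size.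
  Both cases are instances of the one-step estimate \<open>invariant\<close>, where the first label is
  on the grid and the second one is close to it.
\<close>

lemma dISS_lyapunov_imp_approx_bisimilar:
  fixes \<Sigma> :: network
  assumes J: "finite J" "k \<in> J"
    and P: "\<And>j. j \<in> J \<Longrightarrow> P j \<noteq> {}" "(\<Union>j\<in>J. P j) = vertices \<Sigma>" "disjoint_family_on P J"
    and carrier: "\<And>i. i \<in> vertices \<Sigma> \<Longrightarrow> state_set \<Sigma> i \<subseteq> carrier_vec (state_dim \<Sigma> i)"
      "\<And>i. i \<in> vertices \<Sigma> \<Longrightarrow> input_set \<Sigma> i \<subseteq> carrier_vec (input_dim \<Sigma> i)"
    and lyap: "dISS_lyapunov \<Sigma> J P k W \<alpha> \<beta> \<rho> \<sigma> \<tau>"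
    and slow: "\<And>s t. 0 \<le> s \<Longrightarrow> s \<le> t \<Longrightarrow> \<rho> t - \<rho> s \<le> t - s"
    and lip: "lipschitz_constant L (Pi\<^sub>E (P k) (state_set \<Sigma>) \<times> Pi\<^sub>E (P k) (state_set \<Sigma>))
        (pair_dist (fam_dist (P k)) (fam_dist (P k))) (\<lambda>s t. \<bar>s - t\<bar>) (\<lambda>p. W (fst p) (snd p))"
    and eps: "0 < \<epsilon>" and etab: "\<And>j. j \<in> J \<Longrightarrow> 0 < etab j"
    and step_size: "L * etab k + (\<Sum>j\<in>J - {k}. \<tau> j (etab j)) + \<sigma> (etab k) \<le> \<rho> (\<alpha> \<epsilon>)"
    and init_size: "\<beta> (etab k) \<le> \<alpha> \<epsilon>"
    and eta: "\<And>j i. j \<in> J \<Longrightarrow> i \<in> P j \<Longrightarrow> \<eta> i = etab j"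
    and sys: "is_system (component_system \<Sigma> (P k))"
      "\<And>i. i \<in> P k \<Longrightarrow> is_system (quantized_system \<Sigma> \<eta> i)"
    and covers: "\<And>i. i \<in> vertices \<Sigma> \<Longrightarrow> lattice_covers (\<eta> i) (state_set \<Sigma> i)"
      "\<And>i. i \<in> P k \<Longrightarrow> lattice_covers (\<eta> i) (input_set \<Sigma> i)"
  shows "approx_bisimilar \<epsilon> (fam_dist (P k)) (quantized_composition \<Sigma> \<eta> (P k)) (component_system \<Sigma> (P k))"
proof -
  define I where "I = P k"
  define Q where "Q = quantized_composition \<Sigma> \<eta> I"
  define C where "C = component_system \<Sigma> I"
  define X where "X = Pi\<^sub>E I (state_set \<Sigma>)"
  define XQ where "XQ = (\<Pi>\<^sub>E i\<in>I. lattice_in (\<eta> i) (state_set \<Sigma> i))"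
  define U where "U = Pi\<^sub>E I (input_set \<Sigma>)"
  define UQ where "UQ = (\<Pi>\<^sub>E i\<in>I. lattice_in (\<eta> i) (input_set \<Sigma> i))"
  define E where "E = Pi\<^sub>E (vertices \<Sigma> - I) (state_set \<Sigma>)"
  define EQ where "EQ = (\<Pi>\<^sub>E j\<in>vertices \<Sigma> - I. lattice_in (\<eta> j) (state_set \<Sigma> j))"
  note sets = X_def XQ_def U_def UQ_def E_def EQ_def
  have Psub: "P j \<subseteq> vertices \<Sigma>" if "j \<in> J" for j using P(2) that by blast
  have Pfin: "finite (P j)" if "j \<in> J" for j
    using Psub[OF that] by (rule finite_subset) (simp add: vertices_def)
  have I: "finite I" "I \<noteq> {}" "I \<subseteq> vertices \<Sigma>"
    using Pfin Psub P(1) J by (auto simp: I_def)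
  have sub: "XQ \<subseteq> X" "UQ \<subseteq> U" "EQ \<subseteq> E"
    unfolding sets by (rule PiE_lattice_subset)+
  have Xcar: "X \<subseteq> state_space \<Sigma> I"
    unfolding X_def state_space_def using I carrier(1) by (intro PiE_mono) auto
  have Ucar: "U \<subseteq> input_space \<Sigma> I"
    unfolding U_def input_space_def using I carrier(2) by (intro PiE_mono) auto
  have joint: "override_on w x I \<in> state_space \<Sigma> (vertices \<Sigma>)" if "w \<in> E" "x \<in> X" for w x
    unfolding state_space_def
  proof (rule PiE_I)
    fix i assume i: "i \<in> vertices \<Sigma>"
    hence "override_on w x I i \<in> state_set \<Sigma> i"
      using that by (cases "i \<in> I") (auto simp: E_def X_def PiE_iff)
    thus "override_on w x I i \<in> carrier_vec (state_dim \<Sigma> i)" using carrier(1)[OF i] by blast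
  next
    fix i assume "i \<notin> vertices \<Sigma>"
    thus "override_on w x I i = undefined"
      using that(1) I(3) by (auto simp: override_on_def E_def PiE_iff extensional_def)
  qed
  have restrict_joint: "restrict (override_on w x I) I = x" if "x \<in> X" for w x
    using that by (intro extensionalityI[of _ I]) (auto simp: X_def PiE_iff)

  have K: "class_K \<alpha>" "class_K \<beta>" "class_K \<sigma>" "\<And>j. j \<in> J - {k} \<Longrightarrow> class_K (\<tau> j)"
    and bounds: "\<And>\<xi> \<xi>'. \<xi> \<in> state_space \<Sigma> I \<Longrightarrow> \<xi>' \<in> state_space \<Sigma> I \<Longrightarrow>
        \<alpha> (fam_dist I \<xi> \<xi>') \<le> W \<xi> \<xi>' \<and> W \<xi> \<xi>' \<le> \<beta> (fam_dist I \<xi> \<xi>')"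
    and decay: "\<And>x x' \<omega> \<omega>'. x \<in> state_space \<Sigma> (vertices \<Sigma>) \<Longrightarrow> x' \<in> state_space \<Sigma> (vertices \<Sigma>) \<Longrightarrow>
        \<omega> \<in> input_space \<Sigma> I \<Longrightarrow> \<omega>' \<in> input_space \<Sigma> I \<Longrightarrow>
        W (joint_dyn \<Sigma> I x \<omega>) (joint_dyn \<Sigma> I x' \<omega>') - W (restrict x I) (restrict x' I)
        \<le> - \<rho> (W (restrict x I) (restrict x' I))
          + (\<Sum>j\<in>J - {k}. \<tau> j (fam_dist (P j) (restrict x (P j)) (restrict x' (P j))))
          + \<sigma> (fam_dist I \<omega> \<omega>')"
    using lyap unfolding dISS_lyapunov_def I_def by (auto intro: class_Kinf_imp_class_K)
  have dnonneg: "0 \<le> fam_dist I \<xi> \<xi>'" for \<xi> \<xi>' by (rule fam_dist_nonneg[OF I(1,2)])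
  have Wnonneg: "0 \<le> W x z" if "x \<in> X" "z \<in> X" for x z
    using bounds[of x z] Xcar that class_K_nonneg[OF K(1) dnonneg[of x z]] by fastforce
  have close: "W x z \<le> \<alpha> \<epsilon>" if "x \<in> X" "z \<in> X" "fam_dist I x z \<le> etab k" for x z
  proof -
    have "W x z \<le> \<beta> (fam_dist I x z)" using bounds[of x z] Xcar that by blast
    also have "\<dots> \<le> \<beta> (etab k)"
      using class_K_le_iff[OF K(2) dnonneg, of "etab k" x z] etab[OF J(2)] that(3) by simp
    finally show ?thesis using init_size by simp
  qed
  have C_step: "(z, (w, \<omega>), joint_dyn \<Sigma> I (override_on w z I) \<omega>) \<in> sys_trans C"
    if "z \<in> X" "w \<in> E" "\<omega> \<in> U" for z w \<omega>
    using that by (simp add: C_def component_system_def sets)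
  have C_states: "joint_dyn \<Sigma> I (override_on w z I) \<omega> \<in> X"
    if "z \<in> X" "w \<in> E" "\<omega> \<in> U" for z w \<omega>
  proof -
    have "joint_dyn \<Sigma> I (override_on w z I) \<omega> \<in> sys_states C"
      using C_step[OF that] sys(1) unfolding is_system_def C_def I_def[symmetric] by blast
    thus ?thesis by (simp add: C_def component_system_def X_def)
  qed
  have Q_sys: "is_system Q"
    unfolding Q_def using sys(2) by (intro is_system_quantized_composition) (auto simp: I_def)
  define q where "q x w \<omega> = (\<lambda>i\<in>I. quantize (\<eta> i) (joint_dyn \<Sigma> I (override_on w x I) \<omega> i))" for x w \<omega>
  have Q_trans: "(x, (w, \<omega>), x') \<in> sys_trans Q \<longleftrightarrow> x \<in> XQ \<and> w \<in> EQ \<and> \<omega> \<in> UQ \<and> x' = q x w \<omega>"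
    for x w \<omega> x'
    unfolding Q_def sets q_def by (rule quantized_composition_trans_iff[OF I(3)])
  have Q_states: "q x w \<omega> \<in> XQ" if "x \<in> XQ" "w \<in> EQ" "\<omega> \<in> UQ" for x w \<omega>
  proof -
    have "(x, (w, \<omega>), q x w \<omega>) \<in> sys_trans Q" using Q_trans that by simp
    hence "q x w \<omega> \<in> sys_states Q" using Q_sys unfolding is_system_def by blast
    thus ?thesis by (simp add: Q_def quantized_composition_def XQ_def)
  qed

  have invariant: "W (q x w \<omega>) (joint_dyn \<Sigma> I (override_on w' z I) \<omega>') \<le> \<alpha> \<epsilon>"
    if x: "x \<in> XQ" and z: "z \<in> X" and W: "W x z \<le> \<alpha> \<epsilon>"
      and w: "w \<in> EQ" "w' \<in> E" "\<forall>j\<in>vertices \<Sigma> - I. inf_dist (w' j) (w j) \<le> \<eta> j"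
      and \<omega>: "\<omega> \<in> UQ" "\<omega>' \<in> U" "\<forall>i\<in>I. inf_dist (\<omega>' i) (\<omega> i) \<le> \<eta> i" for x z w w' \<omega> \<omega>'
  proof -
    define y where "y = joint_dyn \<Sigma> I (override_on w x I) \<omega>"
    define z' where "z' = joint_dyn \<Sigma> I (override_on w' z I) \<omega>'"
    have mem: "x \<in> X" "w \<in> E" "\<omega> \<in> U" using x w \<omega> sub by blast+
    have y: "y \<in> X" and z': "z' \<in> X" and q: "q x w \<omega> \<in> X"
      using C_states[OF mem] C_states[OF z w(2) \<omega>(2)] Q_states[OF x w(1) \<omega>(1)] sub
      by (auto simp: y_def z'_def)
    \<comment> \<open>Decay towards the unquantized successor \<open>y\<close>; rounding \<open>y\<close> is paid for by the Lipschitz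
      constant afterwards.\<close>
    have "W y z' - W x z \<le> - \<rho> (W x z) + (\<Sum>j\<in>J - {k}. \<tau> j (fam_dist (P j) w w')) + \<sigma> (fam_dist I \<omega> \<omega>')"
    proof -
      have "(\<Sum>j\<in>J - {k}. \<tau> j (fam_dist (P j) (restrict (override_on w x I) (P j))
            (restrict (override_on w' z I) (P j)))) = (\<Sum>j\<in>J - {k}. \<tau> j (fam_dist (P j) w w'))"
      proof (rule sum.cong[OF refl])
        fix j assume "j \<in> J - {k}"
        hence "P j \<inter> I = {}" using P(3) J by (auto simp: disjoint_family_on_def I_def)
        hence "restrict (override_on v u I) (P j) = restrict v (P j)" for u v :: "nat \<Rightarrow> real vec"
          by (auto simp: fun_eq_iff override_on_def)
        thus "\<tau> j (fam_dist (P j) (restrict (override_on w x I) (P j)) (restrict (override_on w' z I) (P j)))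
            = \<tau> j (fam_dist (P j) w w')" by (simp add: fam_dist_restrict)
      qed
      thus ?thesis
        using decay[OF joint[OF mem(2,1)] joint[OF w(2) z], of \<omega> \<omega>'] mem \<omega> Ucar z
        by (auto simp: restrict_joint y_def z'_def)
    qed
    also have "(\<Sum>j\<in>J - {k}. \<tau> j (fam_dist (P j) w w')) \<le> (\<Sum>j\<in>J - {k}. \<tau> j (etab j))"
    proof (rule sum_mono)
      fix j assume j: "j \<in> J - {k}"
      have "inf_dist (w i) (w' i) \<le> etab j" if i: "i \<in> P j" for i
      proof -
        have "i \<notin> I" using P(3) J j i by (auto simp: disjoint_family_on_def I_def)
        hence i': "i \<in> vertices \<Sigma> - I" using Psub[of j] j i by blast
        hence "w i \<in> carrier_vec (state_dim \<Sigma> i)" "w' i \<in> carrier_vec (state_dim \<Sigma> i)"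
          using mem(2) w(2) carrier(1)[of i] by (auto simp: E_def PiE_iff)
        hence "inf_dist (w i) (w' i) = inf_dist (w' i) (w i)" by (rule inf_dist_commute)
        thus ?thesis using bspec[OF w(3) i'] eta[of j i] j i by simp
      qed
      hence "fam_dist (P j) w w' \<le> etab j"
        using Pfin P(1) j by (subst fam_dist_le_iff) auto
      thus "\<tau> j (fam_dist (P j) w w') \<le> \<tau> j (etab j)"
        using class_K_le_iff[OF K(4)[OF j], of "fam_dist (P j) w w'" "etab j"] etab[of j] j
          fam_dist_nonneg[of "P j" w w'] Pfin[of j] P(1)[of j] by auto
    qed
    also have "\<sigma> (fam_dist I \<omega> \<omega>') \<le> \<sigma> (etab k)"
    proof -
      have "inf_dist (\<omega> i) (\<omega>' i) \<le> etab k" if i: "i \<in> I" for i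
      proof -
        have "\<omega> i \<in> carrier_vec (input_dim \<Sigma> i)" "\<omega>' i \<in> carrier_vec (input_dim \<Sigma> i)"
          using mem(3) \<omega>(2) Ucar i by (auto simp: input_space_def PiE_iff)
        hence "inf_dist (\<omega> i) (\<omega>' i) = inf_dist (\<omega>' i) (\<omega> i)" by (rule inf_dist_commute)
        thus ?thesis using bspec[OF \<omega>(3) i] eta[of k i] J i by (simp add: I_def)
      qed
      hence "fam_dist I \<omega> \<omega>' \<le> etab k" using I by (subst fam_dist_le_iff) auto
      thus ?thesis
        using class_K_le_iff[OF K(3) dnonneg, of "etab k" \<omega> \<omega>'] etab[OF J(2)] by simp
    qed
    finally have "W y z' \<le> W x z - \<rho> (W x z) + (\<Sum>j\<in>J - {k}. \<tau> j (etab j)) + \<sigma> (etab k)" by simp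
    moreover have "W (q x w \<omega>) z' \<le> W y z' + L * etab k"
    proof -
      have "fam_dist I (q x w \<omega>) y \<le> etab k"
        unfolding fam_dist_le_iff[OF I(1,2)]
      proof
        fix i assume i: "i \<in> I"
        have "y i \<in> carrier_vec (state_dim \<Sigma> i)" using y Xcar i by (auto simp: state_space_def PiE_iff)
        moreover have "q x w \<omega> i = quantize (\<eta> i) (y i)" using i by (simp add: q_def y_def)
        moreover have "\<eta> i = etab k" using eta[OF J(2)] i by (simp add: I_def)
        moreover have "quantize (\<eta> i) (y i) \<in> carrier_vec (dim_vec (y i))" by (simp add: quantize_def)
        ultimately show "inf_dist (q x w \<omega> i) (y i) \<le> etab k"
          using inf_dist_quantize_le[of "\<eta> i" "y i"] etab[OF J(2)]
            inf_dist_commute[of "y i" "dim_vec (y i)" "quantize (\<eta> i) (y i)"] by simp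
      qed
      hence "pair_dist (fam_dist I) (fam_dist I) (q x w \<omega>, z') (y, z') \<le> etab k"
        using etab[OF J(2)] by (simp add: pair_dist_def fam_dist_self I)
      moreover have "0 \<le> L" and "\<bar>W (q x w \<omega>) z' - W y z'\<bar>
          \<le> L * pair_dist (fam_dist I) (fam_dist I) (q x w \<omega>, z') (y, z')"
        using lip y z' q unfolding lipschitz_constant_def I_def[symmetric] X_def[symmetric] by force+
      ultimately show ?thesis
        using mult_left_mono[of "pair_dist (fam_dist I) (fam_dist I) (q x w \<omega>, z') (y, z')" "etab k" L]
        by linarith
    qed
    ultimately have "W (q x w \<omega>) z' \<le> W x z - \<rho> (W x z) + \<rho> (\<alpha> \<epsilon>)"
      using step_size by linarith
    moreover have "\<rho> (\<alpha> \<epsilon>) - \<rho> (W x z) \<le> \<alpha> \<epsilon> - W x z"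
      using Wnonneg[OF mem(1) z] W by (rule slow)
    ultimately show ?thesis by (simp add: z'_def)
  qed

  define R where "R = {(x, z). x \<in> XQ \<and> z \<in> X \<and> W x z \<le> \<alpha> \<epsilon>}"
  have states: "sys_states Q = XQ" "sys_states C = X" "sys_out Q = (\<lambda>x. x)" "sys_out C = (\<lambda>x. x)"
      "sys_outputs Q = X" "sys_outputs C = X"
    by (simp_all add: Q_def C_def quantized_composition_def component_system_def sets)
  have bisim: "approx_bisimulation \<epsilon> (fam_dist I) Q C R"
    unfolding approx_bisimulation_def
  proof (intro conjI ballI, unfold split_paired_all case_prod_conv)
    show "R \<subseteq> sys_states Q \<times> sys_states C" by (auto simp: R_def states)
  next
    fix x z assume "(x, z) \<in> R"
    hence x: "x \<in> XQ" and z: "z \<in> X" and W: "W x z \<le> \<alpha> \<epsilon>" by (auto simp: R_def)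
    show "fam_dist I (sys_out Q x) (sys_out C z) \<le> \<epsilon> \<and>
      (\<forall>u x'. (x, u, x') \<in> sys_trans Q \<longrightarrow> (\<exists>w z'. (z, w, z') \<in> sys_trans C \<and> (x', z') \<in> R)) \<and>
      (\<forall>w z'. (z, w, z') \<in> sys_trans C \<longrightarrow> (\<exists>u x'. (x, u, x') \<in> sys_trans Q \<and> (x', z') \<in> R))"
    proof (intro conjI allI impI)
      have "\<alpha> (fam_dist I x z) \<le> \<alpha> \<epsilon>"
        using bounds[of x z] x z sub Xcar W by fastforce
      thus "fam_dist I (sys_out Q x) (sys_out C z) \<le> \<epsilon>"
        using class_K_le_iff[OF K(1) dnonneg, of \<epsilon> x z] eps by (simp add: states)
    next
      fix u x' assume "(x, u, x') \<in> sys_trans Q"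
      then obtain w \<omega> where u: "u = (w, \<omega>)" and w: "w \<in> EQ" and \<omega>: "\<omega> \<in> UQ" and x': "x' = q x w \<omega>"
        by (cases u) (auto simp: Q_trans)
      have mem: "w \<in> E" "\<omega> \<in> U" using w \<omega> sub by blast+
      have pos: "0 \<le> \<eta> i" if "i \<in> vertices \<Sigma>" for i
      proof -
        have "i \<in> (\<Union>j\<in>J. P j)" using P(2) that by simp
        then obtain j where j: "j \<in> J" "i \<in> P j" by blast
        show ?thesis using eta[OF j] etab[OF j(1)] by simp
      qed
      have "W x' (joint_dyn \<Sigma> I (override_on w z I) \<omega>) \<le> \<alpha> \<epsilon>"
        unfolding x'
      proof (rule invariant[OF x z W w mem(1) _ \<omega> mem(2)])
        show "\<forall>j\<in>vertices \<Sigma> - I. inf_dist (w j) (w j) \<le> \<eta> j"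
          using pos by (simp add: inf_dist_self)
        show "\<forall>i\<in>I. inf_dist (\<omega> i) (\<omega> i) \<le> \<eta> i"
          using pos subsetD[OF I(3)] by (simp add: inf_dist_self)
      qed
      thus "\<exists>w z'. (z, w, z') \<in> sys_trans C \<and> (x', z') \<in> R"
        using C_step[OF z mem] C_states[OF z mem] Q_states[OF x w \<omega>] x' by (auto simp: R_def)
    next
      fix v z' assume "(z, v, z') \<in> sys_trans C"
      then obtain w' \<omega>' where w': "w' \<in> E" and \<omega>': "\<omega>' \<in> U"
          and z': "z' = joint_dyn \<Sigma> I (override_on w' z I) \<omega>'"
        by (cases v) (auto simp: C_def component_system_def sets)
      obtain w where w: "w \<in> EQ" "\<forall>j\<in>vertices \<Sigma> - I. inf_dist (w' j) (w j) \<le> \<eta> j"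
        using lattice_covers_family[of "vertices \<Sigma> - I" \<eta> "state_set \<Sigma>" w'] covers(1) w'
        by (auto simp: E_def EQ_def)
      obtain \<omega> where \<omega>: "\<omega> \<in> UQ" "\<forall>i\<in>I. inf_dist (\<omega>' i) (\<omega> i) \<le> \<eta> i"
        using lattice_covers_family[of I \<eta> "input_set \<Sigma>" \<omega>'] covers(2) \<omega>'
        by (auto simp: U_def UQ_def I_def)
      have "W (q x w \<omega>) z' \<le> \<alpha> \<epsilon>"
        unfolding z' using x z W w(1) w' w(2) \<omega>(1) \<omega>' \<omega>(2) by (rule invariant)
      thus "\<exists>u x'. (x, u, x') \<in> sys_trans Q \<and> (x', z') \<in> R"
        using Q_trans[of x w \<omega> "q x w \<omega>"] x w \<omega> Q_states[OF x w(1) \<omega>(1)] C_states[OF z w' \<omega>'] z'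
        by (auto simp: R_def)
    qed
  qed

  have total: "\<exists>x\<in>XQ. (x, z) \<in> R" if z: "z \<in> X" for z
  proof -
    obtain x where x: "x \<in> XQ" "\<forall>i\<in>I. inf_dist (z i) (x i) \<le> \<eta> i"
      using lattice_covers_family[of I \<eta> "state_set \<Sigma>" z] covers(1) z I
      by (auto simp: X_def XQ_def)
    have "inf_dist (x i) (z i) \<le> etab k" if i: "i \<in> I" for i
    proof -
      have "x i \<in> carrier_vec (state_dim \<Sigma> i)" "z i \<in> carrier_vec (state_dim \<Sigma> i)"
        using x(1) z sub Xcar i by (auto simp: state_space_def PiE_iff)
      hence "inf_dist (x i) (z i) = inf_dist (z i) (x i)" by (rule inf_dist_commute)
      thus ?thesis using bspec[OF x(2) i] eta[of k i] J i by (simp add: I_def)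
    qed
    hence "fam_dist I x z \<le> etab k" using I by (subst fam_dist_le_iff) auto
    hence "W x z \<le> \<alpha> \<epsilon>" using x z sub by (intro close) auto
    thus ?thesis using x z by (auto simp: R_def)
  qed
  have diagonal: "(x, x) \<in> R" if "x \<in> XQ" for x
    using that sub close[of x x] etab[OF J(2)] by (auto simp: R_def fam_dist_self I)
  have metric: "is_metric_on X (fam_dist I)"
    unfolding X_def using I carrier(1) by (intro is_metric_on_fam_dist[where d = "state_dim \<Sigma>"]) auto
  have "R `` sys_states Q = sys_states C" "R\<inverse> `` sys_states C = sys_states Q"
    unfolding states using total diagonal sub by (auto simp: R_def)
  hence "approx_bisimilar \<epsilon> (fam_dist I) Q C"
    unfolding approx_bisimilar_def metric_system_def states(5,6)
    using bisim metric Q_sys sys(1) by (auto simp: C_def I_def)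
  thus ?thesis by (simp add: Q_def C_def I_def)
qed

theorem theorem3p3:
  fixes \<Sigma> :: network
    and Nbar :: nat and Vk :: "nat \<Rightarrow> nat set" and k :: nat and vs :: "nat list"
    and V :: "nat \<Rightarrow> real vec \<Rightarrow> real vec \<Rightarrow> real"
    and al au rho sig :: "nat \<Rightarrow> real \<Rightarrow> real" and sigx :: "nat \<Rightarrow> nat \<Rightarrow> real \<Rightarrow> real"
    and g :: "nat \<Rightarrow> real \<Rightarrow> real" and a :: "nat \<Rightarrow> real" and c :: "nat \<Rightarrow> nat \<Rightarrow> real"
    and lam :: "nat \<Rightarrow> real"
  assumes net: "control_network \<Sigma>"
    and sccs: "bij_betw Vk {1..Nbar} (pre_digraph.sccs_verts (net_graph \<Sigma>))"
    and k: "k \<in> {1..Nbar}"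
    and vs: "distinct vs" "set vs = Vk k"
    \<comment> \<open>(A1)\<close>
    and A1_V: "\<forall>i\<in>vertices \<Sigma>.
        (\<forall>x\<in>carrier_vec (state_dim \<Sigma> i). \<forall>x'\<in>carrier_vec (state_dim \<Sigma> i). 0 \<le> V i x x') \<and>
        locally_lipschitz (carrier_vec (state_dim \<Sigma> i) \<times> carrier_vec (state_dim \<Sigma> i))
          (pair_dist inf_dist inf_dist) (\<lambda>s t. \<bar>s - t\<bar>) (\<lambda>p. V i (fst p) (snd p))"
    and A1_Kinf: "\<forall>i\<in>vertices \<Sigma>. class_Kinf (al i) \<and> class_Kinf (au i) \<and> class_Kinf (rho i)"
    and A1_K: "\<forall>i\<in>vertices \<Sigma>. class_K (sig i) \<and> (\<forall>j\<in>vertices \<Sigma> - {i}. class_K (sigx i j))"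
    and A1_bounds: "\<forall>i\<in>vertices \<Sigma>.
        \<forall>x\<in>carrier_vec (state_dim \<Sigma> i). \<forall>x'\<in>carrier_vec (state_dim \<Sigma> i).
          al i (inf_dist x x') \<le> V i x x' \<and> V i x x' \<le> au i (inf_dist x x')"
    and A1_decrease: "\<forall>i\<in>vertices \<Sigma>.
        \<forall>x\<in>state_space \<Sigma> (vertices \<Sigma>). \<forall>x'\<in>state_space \<Sigma> (vertices \<Sigma>).
        \<forall>u\<in>carrier_vec (input_dim \<Sigma> i). \<forall>u'\<in>carrier_vec (input_dim \<Sigma> i).
          V i (dyn \<Sigma> i x u) (dyn \<Sigma> i x' u') - V i (x i) (x' i)
            \<le> - rho i (V i (x i) (x' i))
              + (\<Sum>j\<in>vertices \<Sigma> - {i}. sigx i j (inf_dist (x j) (x' j)))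
              + sig i (inf_dist u u')"
    \<comment> \<open>(A2)\<close>
    and A2_g: "\<forall>i\<in>Vk k. class_Kinf (g i)"
    and A2_a: "\<forall>i\<in>Vk k. 0 < a i"
    and A2_c: "\<forall>i\<in>Vk k. \<forall>j\<in>Vk k - {i}. 0 \<le> c i j"
    and A2_rho: "\<forall>i\<in>Vk k. \<forall>s\<ge>0. rho i s \<ge> a i * g i s"
    and A2_sigx: "\<forall>i\<in>Vk k. \<forall>j\<in>Vk k - {i}. \<forall>s\<ge>0.
        sigx i j (inv_into {0..} (al j) s) \<le> c i j * g j s"
    and small_gain: "real_spectral_radius (inverse_matrix (gain_diag vs a) * gain_offdiag vs c) < 1"
    and lam_pos: "\<forall>i\<in>Vk k. 0 < lam i"
    and lam_gain: "positive_vec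
        (row_vec_mult (vec_of_list (map lam vs)) (gain_diag vs a - gain_offdiag vs c))"
  shows "\<exists>alk auk rhok sigk. \<exists>sigxk :: nat \<Rightarrow> real \<Rightarrow> real.
      class_Kinf alk \<and> class_Kinf auk \<and> class_Kinf rhok \<and> class_K sigk \<and>
      (\<forall>j\<in>{1..Nbar} - {k}. class_K (sigxk j)) \<and>
      \<comment> \<open>(i)\<close>
      (\<forall>\<xi>\<in>state_space \<Sigma> (Vk k). \<forall>\<xi>'\<in>state_space \<Sigma> (Vk k).
         alk (fam_dist (Vk k) \<xi> \<xi>') \<le> weighted_sum (Vk k) lam V \<xi> \<xi>' \<and>
         weighted_sum (Vk k) lam V \<xi> \<xi>' \<le> auk (fam_dist (Vk k) \<xi> \<xi>')) \<and>
      \<comment> \<open>(ii)\<close>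
      (\<forall>x\<in>state_space \<Sigma> (vertices \<Sigma>). \<forall>x'\<in>state_space \<Sigma> (vertices \<Sigma>).
       \<forall>\<omega>\<in>input_space \<Sigma> (Vk k). \<forall>\<omega>'\<in>input_space \<Sigma> (Vk k).
         weighted_sum (Vk k) lam V (joint_dyn \<Sigma> (Vk k) x \<omega>) (joint_dyn \<Sigma> (Vk k) x' \<omega>')
           - weighted_sum (Vk k) lam V (restrict x (Vk k)) (restrict x' (Vk k))
         \<le> - rhok (weighted_sum (Vk k) lam V (restrict x (Vk k)) (restrict x' (Vk k)))
           + (\<Sum>j\<in>{1..Nbar} - {k}.
                sigxk j (fam_dist (Vk j) (restrict x (Vk j)) (restrict x' (Vk j))))
           + sigk (fam_dist (Vk k) \<omega> \<omega>')) \<and>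
      \<comment> \<open>approximate bisimilarity\<close>
      (\<forall>L \<epsilon>. \<forall>etab :: nat \<Rightarrow> real. \<forall>eta :: nat \<Rightarrow> real.
         lipschitz_constant L (Pi\<^sub>E (Vk k) (state_set \<Sigma>) \<times> Pi\<^sub>E (Vk k) (state_set \<Sigma>))
           (pair_dist (fam_dist (Vk k)) (fam_dist (Vk k))) (\<lambda>s t. \<bar>s - t\<bar>)
           (\<lambda>p. weighted_sum (Vk k) lam V (fst p) (snd p)) \<longrightarrow>
         0 < \<epsilon> \<longrightarrow>
         (\<forall>l\<in>{1..Nbar}. 0 < etab l) \<longrightarrow>
         L * etab k + (\<Sum>j\<in>{1..Nbar} - {k}. sigxk j (etab j)) + sigk (etab k)
           \<le> rhok (alk \<epsilon>) \<longrightarrow>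
         auk (etab k) \<le> alk \<epsilon> \<longrightarrow>
         (\<forall>l\<in>{1..Nbar}. \<forall>i\<in>Vk l. eta i = etab l) \<longrightarrow>
         \<comment> \<open>the transition systems are well defined\<close>
         is_system (component_system \<Sigma> (Vk k)) \<longrightarrow>
         (\<forall>i\<in>Vk k. is_system (quantized_system \<Sigma> eta i)) \<longrightarrow>
         \<comment> \<open>the quantized sets approximate the state and input sets\<close>
         (\<forall>i\<in>vertices \<Sigma>. lattice_covers (eta i) (state_set \<Sigma> i)) \<longrightarrow>
         (\<forall>i\<in>Vk k. lattice_covers (eta i) (input_set \<Sigma> i)) \<longrightarrow>
         approx_bisimilar \<epsilon> (fam_dist (Vk k))
           (quantized_composition \<Sigma> eta (Vk k)) (component_system \<Sigma> (Vk k)))"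
proof -
  have part: "\<And>j. j \<in> {1..Nbar} \<Longrightarrow> Vk j \<noteq> {}" "(\<Union>j\<in>{1..Nbar}. Vk j) = vertices \<Sigma>"
      "disjoint_family_on Vk {1..Nbar}"
    using sccs_verts_partition[OF wf_digraph_net_graph sccs] by (auto simp: verts_net_graph)
  have gain: "(\<Sum>i\<in>Vk k - {j}. lam i * c i j) < lam j * a j" if "j \<in> Vk k" for j
  proof -
    have "j \<in> set vs" using that vs(2) by simp
    then obtain p where p: "p < length vs" "vs ! p = j"
      unfolding in_set_conv_nth by blast
    let ?r = "row_vec_mult (vec_of_list (map lam vs)) (gain_diag vs a - gain_offdiag vs c)"
    have "dim_vec ?r = length vs"
      by (simp add: row_vec_mult_def gain_diag_def gain_offdiag_def)
    hence "0 < ?r $ p"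
      using lam_gain p(1) unfolding positive_vec_def by metis
    thus ?thesis
      unfolding row_vec_mult_gain_index[OF vs(1) p(1)] p(2) vs(2) by simp
  qed
  have "\<exists>\<alpha> \<beta> \<rho> \<sigma> \<tau>.
      dISS_lyapunov \<Sigma> {1..Nbar} Vk k (weighted_sum (Vk k) lam V) \<alpha> \<beta> \<rho> \<sigma> \<tau> \<and>
      (\<forall>s t. 0 \<le> s \<longrightarrow> s \<le> t \<longrightarrow> \<rho> t - \<rho> s \<le> t - s)"
  proof (rule weighted_sum_dISS_lyapunov[OF finite_atLeastAtMost k part])
    show "class_Kinf (al i)" "class_Kinf (au i)" "class_K (sig i)" if "i \<in> vertices \<Sigma>" for i
      using A1_Kinf A1_K that by auto
    show "class_K (sigx i j)" if "i \<in> vertices \<Sigma>" "j \<in> vertices \<Sigma>" "j \<noteq> i" for i j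
      using A1_K that by auto
    show "al i (inf_dist x x') \<le> V i x x' \<and> V i x x' \<le> au i (inf_dist x x')"
      if "i \<in> vertices \<Sigma>" "x \<in> carrier_vec (state_dim \<Sigma> i)" "x' \<in> carrier_vec (state_dim \<Sigma> i)"
      for i x x'
      using A1_bounds that by simp
    show "V i (dyn \<Sigma> i x u) (dyn \<Sigma> i x' u') - V i (x i) (x' i)
        \<le> - rho i (V i (x i) (x' i))
          + (\<Sum>j\<in>vertices \<Sigma> - {i}. sigx i j (inf_dist (x j) (x' j)))
          + sig i (inf_dist u u')"
      if "i \<in> vertices \<Sigma>" "x \<in> state_space \<Sigma> (vertices \<Sigma>)" "x' \<in> state_space \<Sigma> (vertices \<Sigma>)"
        "u \<in> carrier_vec (input_dim \<Sigma> i)" "u' \<in> carrier_vec (input_dim \<Sigma> i)" for i x x' u u'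
      by (rule A1_decrease[rule_format, OF that])
    show "class_Kinf (g i)" "0 < lam i" if "i \<in> Vk k" for i
      using A2_g lam_pos that by auto
    show "a i * g i s \<le> rho i s" if "i \<in> Vk k" "0 \<le> s" for i s
      using A2_rho that by simp
    show "\<forall>s\<ge>0. sigx i j (inv_into {0..} (al j) s) \<le> c i j * g j s"
      if "i \<in> Vk k" "j \<in> Vk k" "j \<noteq> i" for i j
      using A2_sigx that by simp
    show "(\<Sum>i\<in>Vk k - {j}. lam i * c i j) < lam j * a j" if "j \<in> Vk k" for j
      using that by (rule gain)
  qed
  then obtain \<alpha> \<beta> \<rho> \<sigma> \<tau> where
      lyap: "dISS_lyapunov \<Sigma> {1..Nbar} Vk k (weighted_sum (Vk k) lam V) \<alpha> \<beta> \<rho> \<sigma> \<tau>"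
    and slow: "\<And>s t. 0 \<le> s \<Longrightarrow> s \<le> t \<Longrightarrow> \<rho> t - \<rho> s \<le> t - s" by blast
  have carrier: "state_set \<Sigma> i \<subseteq> carrier_vec (state_dim \<Sigma> i)" "input_set \<Sigma> i \<subseteq> carrier_vec (input_dim \<Sigma> i)"
    if "i \<in> vertices \<Sigma>" for i
    using net that unfolding control_network_def by blast+
  have "\<forall>L \<epsilon>. \<forall>etab :: nat \<Rightarrow> real. \<forall>eta :: nat \<Rightarrow> real.
      lipschitz_constant L (Pi\<^sub>E (Vk k) (state_set \<Sigma>) \<times> Pi\<^sub>E (Vk k) (state_set \<Sigma>))
        (pair_dist (fam_dist (Vk k)) (fam_dist (Vk k))) (\<lambda>s t. \<bar>s - t\<bar>)
        (\<lambda>p. weighted_sum (Vk k) lam V (fst p) (snd p)) \<longrightarrow>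
      0 < \<epsilon> \<longrightarrow>
      (\<forall>l\<in>{1..Nbar}. 0 < etab l) \<longrightarrow>
      L * etab k + (\<Sum>j\<in>{1..Nbar} - {k}. \<tau> j (etab j)) + \<sigma> (etab k) \<le> \<rho> (\<alpha> \<epsilon>) \<longrightarrow>
      \<beta> (etab k) \<le> \<alpha> \<epsilon> \<longrightarrow>
      (\<forall>l\<in>{1..Nbar}. \<forall>i\<in>Vk l. eta i = etab l) \<longrightarrow>
      is_system (component_system \<Sigma> (Vk k)) \<longrightarrow>
      (\<forall>i\<in>Vk k. is_system (quantized_system \<Sigma> eta i)) \<longrightarrow>
      (\<forall>i\<in>vertices \<Sigma>. lattice_covers (eta i) (state_set \<Sigma> i)) \<longrightarrow>
      (\<forall>i\<in>Vk k. lattice_covers (eta i) (input_set \<Sigma> i)) \<longrightarrow>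
      approx_bisimilar \<epsilon> (fam_dist (Vk k))
        (quantized_composition \<Sigma> eta (Vk k)) (component_system \<Sigma> (Vk k))"
  proof (intro allI impI)
    fix L \<epsilon> :: real and etab eta :: "nat \<Rightarrow> real"
    assume lip: "lipschitz_constant L (Pi\<^sub>E (Vk k) (state_set \<Sigma>) \<times> Pi\<^sub>E (Vk k) (state_set \<Sigma>))
        (pair_dist (fam_dist (Vk k)) (fam_dist (Vk k))) (\<lambda>s t. \<bar>s - t\<bar>)
        (\<lambda>p. weighted_sum (Vk k) lam V (fst p) (snd p))"
      and eps: "0 < \<epsilon>" and etab: "\<forall>l\<in>{1..Nbar}. 0 < etab l"
      and step_size: "L * etab k + (\<Sum>j\<in>{1..Nbar} - {k}. \<tau> j (etab j)) + \<sigma> (etab k) \<le> \<rho> (\<alpha> \<epsilon>)"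
      and init_size: "\<beta> (etab k) \<le> \<alpha> \<epsilon>"
      and eta: "\<forall>l\<in>{1..Nbar}. \<forall>i\<in>Vk l. eta i = etab l"
      and sys: "is_system (component_system \<Sigma> (Vk k))"
        "\<forall>i\<in>Vk k. is_system (quantized_system \<Sigma> eta i)"
      and covers: "\<forall>i\<in>vertices \<Sigma>. lattice_covers (eta i) (state_set \<Sigma> i)"
        "\<forall>i\<in>Vk k. lattice_covers (eta i) (input_set \<Sigma> i)"
    show "approx_bisimilar \<epsilon> (fam_dist (Vk k))
        (quantized_composition \<Sigma> eta (Vk k)) (component_system \<Sigma> (Vk k))"
      using finite_atLeastAtMost k part carrier lyap slow lip eps bspec[OF etab] step_size init_size
        bspec[OF bspec[OF eta]] sys(1) bspec[OF sys(2)] bspec[OF covers(1)] bspec[OF covers(2)]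
      by (rule dISS_lyapunov_imp_approx_bisimilar)
  qed
  with lyap show ?thesis
    unfolding dISS_lyapunov_def
    by - (rule exI[of _ \<alpha>], rule exI[of _ \<beta>], rule exI[of _ \<rho>], rule exI[of _ \<sigma>], rule exI[of _ \<tau>],
      elim conjE, intro conjI, assumption+)
qed

end
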